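(* The system $Ay=b$, where $A$ is an invertible $n\times n$ $\mathcal{H}_r(\mathcal{P})$-matrix with $\mathcal{P}$ a dendrogram of (maximum) degree $d$ and height $h$, can be solved iteratively in time $$\mathcal{O}(N rd^2h + nr^2d^4h^2) + Cost(CD),$$ where $N$ is the number of iterations and $Cost(CD)$ is the running time needed to compute a $k$-sparse factorization of $A$ with $k = rd(d-1)(h+1)$.
   Context: Iterations: put $x=Ay-b$. Starting from an arbitrary $y_0$ and $x_0=Ay_0-b$, each iteration picks a column $q_i$ of $Q=A$ and performs $$x_{t+1} = x_t - \frac{x_t^Tq_i}{q_i^Tq_i}\, q_i,\qquad y_{t+1}=y_t-\frac{x_t^Tq_i}{q_i^Tq_i}\,e_i,$$ where $e_i$ is the $i$th unit coordinate vector. "Solved iteratively in time $T$ with $N$ iterations" means that the outcome of $N$ such iterations is computed in time $T$, counted in elementary scalar operations. Dendrogram: a dendrogram $\mathcal{P}$ is a sequence of increasingly finer partitions $P_h,\dots,P_0$ of $\{1,\dots,n\}$, where $P_h$ is the one-block partition and $P_0$ the partition into singletons. It is represented as a rooted tree whose nodes at height $i$ are the sets of $P_i$; the children of a node at height $i$ are its subsets belonging to $P_{i-1}$. The number $h$ is the height; the maximum number of children of a node is the maximum degree $d$. Every node is assumed to consist of consecutive integers. $\mathcal{H}_r(\mathcal{P})$-matrix: an $n\times n$ matrix $A$ is block-partitioned, in rows and columns, according to $P_{h-1}=\{I_1,\dots,I_t\}$ into blocks $A_{I_i\times I_j}$; the diagonal blocks are recursively sub-partitioned according to $P_{h-2}$,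 etc. Elementary blocks are the blocks not further subdivided (off-diagonal blocks arising at any level of this recursion, and $1\times1$ diagonal blocks). $A$ is an $\mathcal{H}_r(\mathcal{P})$-matrix if all elementary blocks have rank at most $r$. $k$-sparse factorization: for $A=CD$ with $c_i$, $d_j$ the columns of $C$, $D$, the forward-overlap $FO(c_i)$ is the list of columns $c_j$, $j\ge i$, whose support intersects that of $c_i$ (support = set of indices of nonzero entries). The factorization is $k$-sparse if $\left|\bigcup_{i\in\mathrm{supp}(d_j)}FO(c_i)\right|\le k$ for all $j$ (each column of $C$ and row of $D$ being nonzero, without loss of generality). *)

theory Defs
  imports
    "HOL-Library.Disjoint_Sets"
    "Jordan_Normal_Form.DL_Rank"
    "Jordan_Normal_Form.DL_Submatrix"
begin

section \<open>Dendrograms and hierarchical matrices\<close>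

text \<open>Indices are \<open>0, \<dots>, n - 1\<close>. \<open>P i\<close> is the partition at height \<open>i\<close>; the values \<open>P i\<close> for
  \<open>i > h\<close> are irrelevant. Consecutive partitions may coincide, which includes the strict reading.\<close>

definition dendrogram :: "nat \<Rightarrow> nat \<Rightarrow> (nat \<Rightarrow> nat set set) \<Rightarrow> bool" where
  "dendrogram n h P \<longleftrightarrow>
     P h = {{..<n}} \<and>
     P 0 = (\<lambda>j. {j}) ` {..<n} \<and>
     (\<forall>i<h. refines {..<n} (P i) (P (Suc i))) \<and>
     (\<forall>i\<le>h. \<forall>X\<in>P i. \<exists>a b. X = {a..<b})"

definition children :: "(nat \<Rightarrow> nat set set) \<Rightarrow> nat \<Rightarrow> nat set \<Rightarrow> nat set set" where
  "children P i X = {Y \<in> P (i - 1). Y \<subseteq> X}"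

definition max_degree :: "nat \<Rightarrow> (nat \<Rightarrow> nat set set) \<Rightarrow> nat" where
  "max_degree h P = Max {card (children P i X) | i X. 1 \<le> i \<and> i \<le> h \<and> X \<in> P i}"

text \<open>The elementary blocks (row set, column set) of the diagonal block belonging to a node \<open>X\<close>
  at the given height.\<close>

primrec elementary_blocks ::
    "(nat \<Rightarrow> nat set set) \<Rightarrow> nat \<Rightarrow> nat set \<Rightarrow> (nat set \<times> nat set) set" where
  "elementary_blocks P 0 X = {(X, X)}"
| "elementary_blocks P (Suc i) X =
     {(I, J). I \<in> children P (Suc i) X \<and> J \<in> children P (Suc i) X \<and> I \<noteq> J} \<union>
     (\<Union>I \<in> children P (Suc i) X. elementary_blocks P i I)"

definition mat_rank :: "real mat \<Rightarrow> nat" where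
  "mat_rank M = vec_space.rank (dim_row M) M"

definition hierarchical_mat :: "nat \<Rightarrow> nat \<Rightarrow> (nat \<Rightarrow> nat set set) \<Rightarrow> nat \<Rightarrow> real mat \<Rightarrow> bool" where
  "hierarchical_mat n h P r A \<longleftrightarrow>
     A \<in> carrier_mat n n \<and>
     (\<forall>(I, J) \<in> elementary_blocks P h {..<n}. mat_rank (submatrix A I J) \<le> r)"

section \<open>Sparse factorizations\<close>

definition supp :: "real vec \<Rightarrow> nat set" where
  "supp v = {i. i < dim_vec v \<and> v $ i \<noteq> 0}"

text \<open>Columns are identified with their indices, so equal columns at different positions are
  counted separately.\<close>

definition forward_overlap :: "real mat \<Rightarrow> nat \<Rightarrow> nat set" where
  "forward_overlap C i = {j. i \<le> j \<and> j < dim_col C \<and> supp (col C i) \<inter> supp (col C j) \<noteq> {}}"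

definition sparse_factorization :: "nat \<Rightarrow> real mat \<Rightarrow> real mat \<Rightarrow> real mat \<Rightarrow> bool" where
  "sparse_factorization k A C D \<longleftrightarrow>
     dim_row C = dim_row A \<and> dim_col C = dim_row D \<and> dim_col D = dim_col A \<and>
     A = C * D \<and>
     (\<forall>i < dim_col C. supp (col C i) \<noteq> {}) \<and>
     (\<forall>i < dim_row D. supp (row D i) \<noteq> {}) \<and>
     (\<forall>j < dim_col D. card (\<Union>i \<in> supp (col D j). forward_overlap C i) \<le> k)"

section \<open>The iteration\<close>

text \<open>The state is the pair \<open>(x, y)\<close>; both components are updated with the old \<open>x\<close>.\<close>

definition iteration_step :: "real mat \<Rightarrow> nat \<Rightarrow> real vec \<times> real vec \<Rightarrow> real vec \<times> real vec" where
  "iteration_step A i = (\<lambda>(x, y).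
     let q = col A i; \<alpha> = (x \<bullet> q) / (q \<bullet> q)
     in (x - \<alpha> \<cdot>\<^sub>v q, y - \<alpha> \<cdot>\<^sub>v unit_vec (dim_col A) i))"

text \<open>\<open>picks\<close> lists the chosen columns in order; its length is the number of iterations.\<close>

definition iterates :: "real mat \<Rightarrow> real vec \<Rightarrow> real vec \<Rightarrow> nat list \<Rightarrow> real vec \<times> real vec" where
  "iterates A b y0 picks = fold (iteration_step A) picks (A *\<^sub>v y0 - b, y0)"

section \<open>Counting elementary scalar operations\<close>

text \<open>
  Programs are algebraic computation trees over the reals: finite trees whose nodes load a
  constant, perform one arithmetic operation on stored scalars, or branch on one comparison of
  stored scalars. Each such node costs one unit. A program is fixed before the numerical data are
  known and can access them only through these nodes. What is returned at a leaf is
  combinatorial (where results are stored, which code to run next) and is determined by the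
  branches taken. As only operations on scalars are counted, addressing is free.
  Division by zero yields zero, as everywhere in HOL.
\<close>

datatype arith_op = Plus | Minus | Times | Divide

primrec apply_op :: "arith_op \<Rightarrow> real \<Rightarrow> real \<Rightarrow> real" where
  "apply_op Plus a b = a + b"
| "apply_op Minus a b = a - b"
| "apply_op Times a b = a * b"
| "apply_op Divide a b = a / b"

datatype ('l, 'a) prog =
    Return 'a
  | LoadConst 'l real "('l, 'a) prog"
  | Arith 'l arith_op 'l 'l "('l, 'a) prog"
  | IfLe 'l 'l "('l, 'a) prog" "('l, 'a) prog"

text \<open>\<open>Arith z f x y p\<close> assigns to location \<open>z\<close> the value of \<open>f\<close> applied to the contents of \<open>x\<close> and
  \<open>y\<close>. The execution of a program yields its leaf, the final store and the number of operations.\<close>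

primrec exec :: "('l, 'a) prog \<Rightarrow> ('l \<Rightarrow> real) \<Rightarrow> 'a \<times> ('l \<Rightarrow> real) \<times> nat" where
  "exec (Return a) s = (a, s, 0)"
| "exec (LoadConst z c p) s =
     (case exec p (s(z := c)) of (a, s', t) \<Rightarrow> (a, s', Suc t))"
| "exec (Arith z f x y p) s =
     (case exec p (s(z := apply_op f (s x) (s y))) of (a, s', t) \<Rightarrow> (a, s', Suc t))"
| "exec (IfLe x y p q) s =
     (case (if s x \<le> s y then exec p s else exec q s) of (a, s', t) \<Rightarrow> (a, s', Suc t))"

text \<open>Locations holding the input, and working registers, which are initially zero.\<close>

datatype 'i loc = In 'i | Reg nat

definition init_store :: "('i \<Rightarrow> real) \<Rightarrow> 'i loc \<Rightarrow> real" where
  "init_store v l = (case l of In i \<Rightarrow> v i | Reg _ \<Rightarrow> 0)"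

subsection \<open>Programs computing a sparse factorization\<close>

text \<open>The input of a factorization program is the matrix alone.\<close>

definition mat_input :: "nat \<Rightarrow> real mat \<Rightarrow> nat \<times> nat \<Rightarrow> real" where
  "mat_input n A = (\<lambda>(i, j). if i < n \<and> j < n then A $$ (i, j) else 0)"

text \<open>The factors are returned in sparse format: the inner dimension, and for each position of
  \<open>C\<close> and of \<open>D\<close> either \<open>None\<close>, for a zero entry, or the location of the nonzero entry.\<close>

record 'l factors =
  width :: nat
  entry_C :: "nat \<Rightarrow> nat \<Rightarrow> 'l option"
  entry_D :: "nat \<Rightarrow> nat \<Rightarrow> 'l option"

definition stored_mat ::
    "nat \<Rightarrow> nat \<Rightarrow> (nat \<Rightarrow> nat \<Rightarrow> 'l option) \<Rightarrow> ('l \<Rightarrow> real) \<Rightarrow> real mat" where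
  "stored_mat nr nc e s =
     mat nr nc (\<lambda>(i, j). case e i j of None \<Rightarrow> 0 | Some l \<Rightarrow> s l)"

definition only_nonzeros ::
    "nat \<Rightarrow> nat \<Rightarrow> (nat \<Rightarrow> nat \<Rightarrow> 'l option) \<Rightarrow> ('l \<Rightarrow> real) \<Rightarrow> bool" where
  "only_nonzeros nr nc e s \<longleftrightarrow> (\<forall>i<nr. \<forall>j<nc. \<forall>l. e i j = Some l \<longrightarrow> s l \<noteq> 0)"

type_synonym fact_prog = "((nat \<times> nat) loc, (nat \<times> nat) loc factors) prog"

definition run_factorization ::
    "nat \<Rightarrow> fact_prog \<Rightarrow> real mat \<Rightarrow>
     (nat \<times> nat) loc factors \<times> ((nat \<times> nat) loc \<Rightarrow> real) \<times> nat" where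
  "run_factorization n F A = exec F (init_store (mat_input n A))"

definition computes_sparse_factorization :: "nat \<Rightarrow> nat \<Rightarrow> fact_prog \<Rightarrow> real mat \<Rightarrow> bool" where
  "computes_sparse_factorization n k F A \<longleftrightarrow>
     (case run_factorization n F A of (R, s, _) \<Rightarrow>
        only_nonzeros n (width R) (entry_C R) s \<and>
        only_nonzeros (width R) n (entry_D R) s \<and>
        sparse_factorization k A
          (stored_mat n (width R) (entry_C R) s) (stored_mat (width R) n (entry_D R) s))"

definition factorization_cost :: "nat \<Rightarrow> fact_prog \<Rightarrow> real mat \<Rightarrow> nat" where
  "factorization_cost n F A = (case run_factorization n F A of (_, _, t) \<Rightarrow> t)"

subsection \<open>Iterative solvers\<close>

datatype solver_input = InA nat nat | InB nat | InY nat

primrec system_input ::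
    "nat \<Rightarrow> real mat \<Rightarrow> real vec \<Rightarrow> real vec \<Rightarrow> solver_input \<Rightarrow> real" where
  "system_input n A b y0 (InA i j) = (if i < n \<and> j < n then A $$ (i, j) else 0)"
| "system_input n A b y0 (InB i) = (if i < n then b $ i else 0)"
| "system_input n A b y0 (InY i) = (if i < n then y0 $ i else 0)"

text \<open>A solver is a preprocessing program which returns the code for the iterations: one program
  per column that may be picked, and a final program returning the locations of the entries of
  \<open>x\<close> and \<open>y\<close>. Thus the picks are processed online: neither the preprocessing nor the code of an
  iteration depends on the other picks or on the number of iterations.\<close>

record 'l iteration_code =
  step_code :: "nat \<Rightarrow> ('l, unit) prog"
  final_code :: "('l, (nat \<Rightarrow> 'l) \<times> (nat \<Rightarrow> 'l)) prog"

type_synonym solver = "(solver_input loc, solver_input loc iteration_code) prog"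

primrec exec_steps ::
    "(nat \<Rightarrow> ('l, unit) prog) \<Rightarrow> nat list \<Rightarrow> ('l \<Rightarrow> real) \<Rightarrow> ('l \<Rightarrow> real) \<times> nat" where
  "exec_steps p [] s = (s, 0)"
| "exec_steps p (i # is) s =
     (case exec (p i) s of (_, s', t) \<Rightarrow>
      case exec_steps p is s' of (s'', t') \<Rightarrow> (s'', t + t'))"

text \<open>The vectors computed by a solver and the total number of operations.\<close>

definition run_solver ::
    "nat \<Rightarrow> solver \<Rightarrow> real mat \<Rightarrow> real vec \<Rightarrow> real vec \<Rightarrow> nat list \<Rightarrow>
     (real vec \<times> real vec) \<times> nat" where
  "run_solver n S A b y0 picks =
     (case exec S (init_store (system_input n A b y0)) of (code, s1, t1) \<Rightarrow>
      case exec_steps (step_code code) picks s1 of (s2, t2) \<Rightarrow>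
      case exec (final_code code) s2 of ((lx, ly), s3, t3) \<Rightarrow>
        ((vec n (\<lambda>i. s3 (lx i)), vec n (\<lambda>i. s3 (ly i))), t1 + t2 + t3))"

definition solves_iteratively_within ::
    "nat \<Rightarrow> solver \<Rightarrow> real mat \<Rightarrow> real vec \<Rightarrow> real vec \<Rightarrow> nat list \<Rightarrow> nat \<Rightarrow> bool" where
  "solves_iteratively_within n S A b y0 picks T \<longleftrightarrow>
     (case run_solver n S A b y0 picks of (xy, t) \<Rightarrow> xy = iterates A b y0 picks \<and> t \<le> T)"

end

theory Submission
  imports Defs "HOL-Library.Countable"
begin

text \<open>Splitting every elementary block by pivot elimination into at most \<open>r\<close> rank-one terms and listing
  the terms by increasing height gives \<open>A = C D\<close>. A column index \<open>j\<close> lies in one node per height,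
  and the terms that meet the row sets of the blocks above \<open>j\<close> sit, at each height, in the blocks of
  that node; this yields the sparsity bound. Which entries vanish is decided by evaluating
  the finitely many rational expressions that can occur and branching on their zero pattern.

  For the iteration let \<open>L\<close> be lower triangular with \<open>L + L\<^sup>T = 2 C\<^sup>T C\<close>. Then
  \<open>2 x\<^sup>T q\<^sub>j = (D y)\<^sup>T L d\<^sub>j + (L D y)\<^sup>T d\<^sub>j - 2 b\<^sup>T q\<^sub>j\<close>, and the columns \<open>d\<^sub>j\<close> of \<open>D\<close> and \<open>L d\<^sub>j\<close> have at
  most \<open>k\<close> nonzero entries. Storing \<open>D y\<close> and \<open>L D y\<close> instead of \<open>x\<close> makes an iteration cost \<open>O(k)\<close>.
  A row of \<open>C\<close> has at most \<open>k\<close> nonzero entries, since they all belong to the forward overlap of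
  the first one; hence the Gram entries and \<open>L D\<close> are computed in time \<open>O(n k\<^sup>2)\<close>.\<close>

text \<open>Why \<open>L\<close> and not the Gram matrix \<open>C^T C\<close>: k-sparseness bounds,
  for each column of \<open>C\<close>, only the later columns that meet it. So \<open>L d_j\<close>
  is sparse while \<open>C^T C d_j\<close> need not be. The missing upper half is recovered by
  moving \<open>L^T\<close> to the other argument, and the price is that \<open>L D y\<close> is
  maintained besides \<open>D y\<close>.

  Programs are fixed before the entries are known, but which pivots are nonzero and which factor
  entries vanish depends on the entries. At most \<open>r\<close> pivots inside an n x n matrix give
  finitely many expressions, the same for all matrices, and their zero pattern determines everything
  combinatorial. The resulting program is very wasteful, which is harmless: the time bound charges
  the cost of whatever factorization program is given.

  The constant: an iteration costs at most \<open>19 k\<close>, setup and output together at most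
  \<open>33 n k^2\<close>, and \<open>k \<le> 2 r d^2 h\<close> because \<open>h\<close> is at least
  1. Hence 132 = 4 * 33.\<close>

section \<open>Composing programs\<close>

primrec bind_prog :: "('l, 'a) prog \<Rightarrow> ('a \<Rightarrow> ('l, 'b) prog) \<Rightarrow> ('l, 'b) prog" where
  "bind_prog (Return a) f = f a"
| "bind_prog (LoadConst z c p) f = LoadConst z c (bind_prog p f)"
| "bind_prog (Arith z g x y p) f = Arith z g x y (bind_prog p f)"
| "bind_prog (IfLe x y p q) f = IfLe x y (bind_prog p f) (bind_prog q f)"

lemma exec_bind_prog:
  "exec (bind_prog p f) s =
     (case exec p s of (a, s', t) \<Rightarrow> case exec (f a) s' of (b, s'', t') \<Rightarrow> (b, s'', t + t'))"
  by (induction p arbitrary: s) (auto split: prod.splits)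

text \<open>Lets a program run inside the part \<open>range \<phi>\<close> of a larger store.
  Injectivity makes a write at \<open>\<phi> z\<close> visible through \<open>\<phi>\<close> as a
  write at \<open>z\<close> alone, so the renamed run mirrors the original one step by step.\<close>

lemma exec_map_prog:
  assumes "inj \<phi>" and "exec p (s \<circ> \<phi>) = (a, s', t)"
  obtains s'' where "exec (map_prog \<phi> (\<lambda>a. a) p) s = (a, s'', t)" and "s'' \<circ> \<phi> = s'"
    and "\<And>l. l \<notin> range \<phi> \<Longrightarrow> s'' l = s l"
proof -
  have upd: "(\<lambda>l. (s(\<phi> z := c)) (\<phi> l)) = (\<lambda>l. s (\<phi> l))(z := c)" for s :: "'b \<Rightarrow> real" and z c
    using assms(1) by (auto simp: fun_eq_iff inj_eq)
  have "\<exists>s''. exec (map_prog \<phi> (\<lambda>a. a) p) s = (a, s'', t) \<and> s'' \<circ> \<phi> = s' \<and>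
          (\<forall>l. l \<notin> range \<phi> \<longrightarrow> s'' l = s l)"
    using assms(2)
  proof (induction p arbitrary: s t)
    case (Return x)
    then show ?case by auto
  next
    case (LoadConst z c p)
    obtain t1 where t1: "exec p ((s(\<phi> z := c)) \<circ> \<phi>) = (a, s', t1)" "t = Suc t1"
      using LoadConst.prems by (auto simp: upd comp_def simp del: fun_upd_apply split: prod.splits)
    obtain s'' where "exec (map_prog \<phi> (\<lambda>a. a) p) (s(\<phi> z := c)) = (a, s'', t1)" "s'' \<circ> \<phi> = s'"
        "\<forall>l. l \<notin> range \<phi> \<longrightarrow> s'' l = (s(\<phi> z := c)) l"
      using LoadConst.IH[OF t1(1)] by blast
    then show ?case using t1(2) by (intro exI[of _ s'']) auto
  next
    case (Arith z g x y p)
    obtain t1 where t1: "exec p ((s(\<phi> z := apply_op g (s (\<phi> x)) (s (\<phi> y)))) \<circ> \<phi>) = (a, s', t1)"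
        "t = Suc t1"
      using Arith.prems by (auto simp: upd comp_def simp del: fun_upd_apply split: prod.splits)
    obtain s'' where "exec (map_prog \<phi> (\<lambda>a. a) p) (s(\<phi> z := apply_op g (s (\<phi> x)) (s (\<phi> y)))) = (a, s'', t1)" "s'' \<circ> \<phi> = s'"
        "\<forall>l. l \<notin> range \<phi> \<longrightarrow> s'' l = (s(\<phi> z := apply_op g (s (\<phi> x)) (s (\<phi> y)))) l"
      using Arith.IH[OF t1(1)] by blast
    then show ?case using t1(2) by (intro exI[of _ s'']) auto
  next
    case (IfLe x y p q)
    show ?case
    proof (cases "s (\<phi> x) \<le> s (\<phi> y)")
      case True
      then obtain t1 where t1: "exec p (s \<circ> \<phi>) = (a, s', t1)" "t = Suc t1"
        using IfLe.prems by (auto simp: comp_def split: prod.splits)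
      obtain s'' where "exec (map_prog \<phi> (\<lambda>a. a) p) s = (a, s'', t1)" "s'' \<circ> \<phi> = s'"
          "\<forall>l. l \<notin> range \<phi> \<longrightarrow> s'' l = s l"
        using IfLe.IH(1)[OF t1(1)] by blast
      then show ?thesis using t1(2) True by (intro exI[of _ s'']) simp
    next
      case False
      then obtain t1 where t1: "exec q (s \<circ> \<phi>) = (a, s', t1)" "t = Suc t1"
        using IfLe.prems by (auto simp: comp_def split: prod.splits)
      obtain s'' where "exec (map_prog \<phi> (\<lambda>a. a) q) s = (a, s'', t1)" "s'' \<circ> \<phi> = s'"
          "\<forall>l. l \<notin> range \<phi> \<longrightarrow> s'' l = s l"
        using IfLe.IH(2)[OF t1(1)] by blast
      then show ?thesis using t1(2) False by (intro exI[of _ s'']) simp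
    qed
  qed
  then show ?thesis using that by blast
qed

text \<open>Clearing the scratch location \<open>t\<close> after each use makes the effect of a product sum an exact
  function of the store.\<close>

primrec accumulate_list ::
    "'l \<Rightarrow> 'e list \<Rightarrow> ('e \<Rightarrow> 'l) \<Rightarrow> ('e \<Rightarrow> 'l) \<Rightarrow> ('e \<Rightarrow> 'l) \<Rightarrow> ('l, 'a) prog \<Rightarrow> ('l, 'a) prog" where
  "accumulate_list t [] z x y p = p"
| "accumulate_list t (e # es) z x y p =
     Arith t Times (x e) (y e) (Arith (z e) Plus (z e) t (Arith t Minus t t
       (accumulate_list t es z x y p)))"

definition accumulate ::
    "'l \<Rightarrow> 'e set \<Rightarrow> ('e \<Rightarrow> 'l) \<Rightarrow> ('e \<Rightarrow> 'l) \<Rightarrow> ('e \<Rightarrow> 'l) \<Rightarrow> ('l, 'a) prog \<Rightarrow> ('l, 'a) prog" where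
  "accumulate t E = accumulate_list t (SOME es. distinct es \<and> set es = E)"

definition added ::
    "'e set \<Rightarrow> ('e \<Rightarrow> 'l) \<Rightarrow> ('e \<Rightarrow> 'l) \<Rightarrow> ('e \<Rightarrow> 'l) \<Rightarrow> ('l \<Rightarrow> real) \<Rightarrow> 'l \<Rightarrow> real" where
  "added E z x y s l = s l + (\<Sum>e | e \<in> E \<and> z e = l. s (x e) * s (y e))"

lemma exec_accumulate_list:
  assumes "s t = 0" and "distinct es"
    and "t \<notin> z ` set es" and "t \<notin> x ` set es" and "t \<notin> y ` set es"
    and "z ` set es \<inter> x ` set es = {}" and "z ` set es \<inter> y ` set es = {}"
  shows "exec (accumulate_list t es z x y p) s =
    (case exec p (added (set es) z x y s) of (a, s', n) \<Rightarrow> (a, s', 3 * length es + n))"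
  using assms
proof (induction es arbitrary: s)
  case Nil
  have "added (set []) z x y s = s" by (simp add: added_def fun_eq_iff)
  then show ?case by simp
next
  case (Cons e es)
  let ?s = "s(z e := s (z e) + s (x e) * s (y e))"
  \<comment> \<open>\<open>t\<close> held 0 before, so clearing it restores the old store exactly,
    up to the target \<open>z e\<close>.\<close>
  have st: "(s(t := s (x e) * s (y e), z e := s (z e) + s (x e) * s (y e), t := 0)) = ?s"
    using Cons.prems by auto
  have src: "?s (x e') = s (x e')" "?s (y e') = s (y e')" if "e' \<in> set es" for e'
  proof -
    have "x e' \<in> x ` set (e # es)" "y e' \<in> y ` set (e # es)" "z e \<in> z ` set (e # es)"
      using that by auto
    then have "x e' \<noteq> z e" "y e' \<noteq> z e" using Cons.prems(6,7) by (metis disjoint_iff)+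
    then show "?s (x e') = s (x e')" "?s (y e') = s (y e')" by auto
  qed
  have "added (set es) z x y ?s = added (set (e # es)) z x y s"
  proof
    fix l
    have *: "(\<Sum>e | e \<in> set es \<and> z e = l. ?s (x e) * ?s (y e)) =
          (\<Sum>e | e \<in> set es \<and> z e = l. s (x e) * s (y e))"
      by (rule sum.cong) (auto simp: src simp del: fun_upd_apply)
    have "e \<notin> set es" using Cons.prems by simp
    moreover have "{e' \<in> set (e # es). z e' = l} =
        (if z e = l then insert e {e' \<in> set es. z e' = l} else {e' \<in> set es. z e' = l})"
      by auto
    ultimately show "added (set es) z x y ?s l = added (set (e # es)) z x y s l"
      unfolding added_def * by simp
  qed
  moreover have "exec (accumulate_list t es z x y p) ?s =
    (case exec p (added (set es) z x y ?s) of (a, s', n) \<Rightarrow> (a, s', 3 * length es + n))"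
    using Cons.prems by (intro Cons.IH) auto
  moreover have "z e \<noteq> t" using Cons.prems by auto
  ultimately show ?case using st by (auto split: prod.splits)
qed

text \<open>No target is a source, so every product reads the initial store and the order chosen by
  \<open>SOME\<close> does not matter. The factor 3 counts multiplying, adding and clearing.\<close>

lemma exec_accumulate:
  assumes "s t = 0" and "finite E"
    and "\<And>e. e \<in> E \<Longrightarrow> z e \<noteq> t \<and> x e \<noteq> t \<and> y e \<noteq> t"
    and "\<And>e e'. e \<in> E \<Longrightarrow> e' \<in> E \<Longrightarrow> z e \<noteq> x e' \<and> z e \<noteq> y e'"
  shows "exec (accumulate t E z x y p) s =
    (case exec p (added E z x y s) of (a, s', n) \<Rightarrow> (a, s', 3 * card E + n))"
proof -
  define es where "es = (SOME es. distinct es \<and> set es = E)"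
  have "\<exists>es. distinct es \<and> set es = E" using finite_distinct_list[OF assms(2)] by auto
  then have "distinct es \<and> set es = E" unfolding es_def by (rule someI_ex)
  then have es: "distinct es" "set es = E" by auto
  have "t \<notin> z ` set es" "t \<notin> x ` set es" "t \<notin> y ` set es"
    "z ` set es \<inter> x ` set es = {}" "z ` set es \<inter> y ` set es = {}"
    using assms(3,4) unfolding es(2) by blast+
  from exec_accumulate_list[of s t es z x y, OF assms(1) es(1) this] show ?thesis
    using es distinct_card[of es] unfolding accumulate_def es_def by simp
qed

section \<open>The sparse iteration\<close>

text \<open>\<open>Fwd\<close> holds the matrix \<open>L\<close> above, \<open>Ctb\<close> the vector \<open>C\<^sup>T b\<close>, and \<open>Colb\<close> and \<open>Colsq\<close> the inner
  products of the columns of \<open>A\<close> with \<open>b\<close> and with themselves.\<close>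

datatype work = Tmp | MinusOne | MinusTwo | MinusHalf | Alpha | Dy nat | Fwd nat nat | FwdDy nat
  | FwdD nat nat | Ctb nat | Colb nat | Colsq nat | Resid nat

instance work :: countable
  by countable_datatype

text \<open>Odd registers, whereas \<open>relocate\<close> sends the registers of the factorization
  program to even ones. The relocated run therefore leaves all working quantities at zero.\<close>

definition wloc :: "work \<Rightarrow> solver_input loc" where
  "wloc w = Reg (Suc (2 * to_nat w))"

definition relocate :: "(nat \<times> nat) loc \<Rightarrow> solver_input loc" where
  "relocate l = (case l of In (i, j) \<Rightarrow> In (InA i j) | Reg m \<Rightarrow> Reg (2 * m))"

lemma inj_relocate: "inj relocate"
  by (auto simp: inj_def relocate_def split: loc.splits)

lemma wloc_eq_iff [simp]: "wloc w = wloc w' \<longleftrightarrow> w = w'"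
  by (simp add: wloc_def)

lemma wloc_neq_In [simp]: "wloc w \<noteq> In a" "In a \<noteq> wloc w"
  by (simp_all add: wloc_def)

lemma wloc_neq_relocate [simp]: "wloc w \<noteq> relocate l" "relocate l \<noteq> wloc w"
proof -
  have "Suc (2 * a) \<noteq> 2 * b" for a b :: nat by presburger
  then show "wloc w \<noteq> relocate l" by (auto simp: wloc_def relocate_def split: loc.splits)
  then show "relocate l \<noteq> wloc w" by simp
qed

lemma relocate_neq_vector_input [simp]:
  "relocate l \<noteq> In (InY j)" "In (InY j) \<noteq> relocate l"
  "relocate l \<noteq> In (InB j)" "In (InB j) \<noteq> relocate l"
  by (auto simp: relocate_def split: loc.splits)

type_synonym fact_result = "(nat \<times> nat) loc factors"

text \<open>Meaningful only on \<open>C_support\<close>, where the option is not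
  \<open>None\<close>; the code below reads it nowhere else.\<close>

definition cloc :: "fact_result \<Rightarrow> nat \<Rightarrow> nat \<Rightarrow> solver_input loc" where
  "cloc R p i = relocate (the (entry_C R p i))"

definition dloc :: "fact_result \<Rightarrow> nat \<Rightarrow> nat \<Rightarrow> solver_input loc" where
  "dloc R i j = relocate (the (entry_D R i j))"

lemma loc_neq [simp]:
  "wloc w \<noteq> cloc R p i" "cloc R p i \<noteq> wloc w" "wloc w \<noteq> dloc R p i" "dloc R p i \<noteq> wloc w"
  "In (InY j) \<noteq> cloc R p i" "cloc R p i \<noteq> In (InY j)"
  "In (InY j) \<noteq> dloc R p i" "dloc R p i \<noteq> In (InY j)"
  by (simp_all add: cloc_def dloc_def)

definition C_support :: "nat \<Rightarrow> fact_result \<Rightarrow> (nat \<times> nat) set" where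
  "C_support n R = {(p, i). p < n \<and> i < width R \<and> entry_C R p i \<noteq> None}"

definition D_support :: "nat \<Rightarrow> fact_result \<Rightarrow> (nat \<times> nat) set" where
  "D_support n R = {(i, j). i < width R \<and> j < n \<and> entry_D R i j \<noteq> None}"

text \<open>The positions, row index first, at which \<open>L\<close> may be nonzero. An inner
  product that cancels is still included.\<close>

definition overlap :: "nat \<Rightarrow> fact_result \<Rightarrow> (nat \<times> nat) set" where
  "overlap n R = {(i', i). i \<le> i' \<and> (\<exists>p. (p, i) \<in> C_support n R \<and> (p, i') \<in> C_support n R)}"

text \<open>The set whose size k-sparseness bounds. It contains the support of \<open>L d_j\<close>,
  hence of column \<open>j\<close> of \<open>L D\<close>.\<close>

definition reach :: "nat \<Rightarrow> fact_result \<Rightarrow> nat \<Rightarrow> nat set" where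
  "reach n R j = {i'. \<exists>i. (i, j) \<in> D_support n R \<and> (i', i) \<in> overlap n R}"

definition D_column :: "nat \<Rightarrow> fact_result \<Rightarrow> nat \<Rightarrow> nat set" where
  "D_column n R j = {i. (i, j) \<in> D_support n R}"

definition row_pairs :: "nat \<Rightarrow> fact_result \<Rightarrow> (nat \<times> nat \<times> nat) set" where
  "row_pairs n R = {(p, i', i). (p, i') \<in> C_support n R \<and> (p, i) \<in> C_support n R \<and> i \<le> i'}"

text \<open>Adding these products a second time doubles \<open>L\<close> below the diagonal and
  leaves the diagonal single, as \<open>L + L^T = 2 C^T C\<close> requires.\<close>

definition strict_row_pairs :: "nat \<Rightarrow> fact_result \<Rightarrow> (nat \<times> nat \<times> nat) set" where
  "strict_row_pairs n R = {(p, i', i). (p, i', i) \<in> row_pairs n R \<and> i < i'}"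

definition overlap_column_pairs :: "nat \<Rightarrow> fact_result \<Rightarrow> (nat \<times> nat \<times> nat) set" where
  "overlap_column_pairs n R = {(i', i, j). (i', i) \<in> overlap n R \<and> (i, j) \<in> D_support n R}"

text \<open>\<open>Alpha\<close> first collects twice the inner product of \<open>x\<close> with the
  picked column. Division by \<open>Colsq\<close> and the factor -1/2 turn it into the negated
  coefficient, so that all updates are additions.\<close>

definition step_prog :: "nat \<Rightarrow> fact_result \<Rightarrow> nat \<Rightarrow> (solver_input loc, unit) prog" where
  "step_prog n R j =
    Arith (wloc Alpha) Minus (wloc Alpha) (wloc Alpha)
    (accumulate (wloc Tmp) (reach n R j)
      (\<lambda>i. wloc Alpha) (\<lambda>i. wloc (Dy i)) (\<lambda>i. wloc (FwdD i j))
    (accumulate (wloc Tmp) (D_column n R j)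
      (\<lambda>i. wloc Alpha) (\<lambda>i. wloc (FwdDy i)) (\<lambda>i. dloc R i j)
    (accumulate (wloc Tmp) {()}
      (\<lambda>_. wloc Alpha) (\<lambda>_. wloc MinusTwo) (\<lambda>_. wloc (Colb j))
    (Arith (wloc Alpha) Divide (wloc Alpha) (wloc (Colsq j))
    (Arith (wloc Alpha) Times (wloc Alpha) (wloc MinusHalf)
    (accumulate (wloc Tmp) (D_column n R j)
      (\<lambda>i. wloc (Dy i)) (\<lambda>i. wloc Alpha) (\<lambda>i. dloc R i j)
    (accumulate (wloc Tmp) (reach n R j)
      (\<lambda>i. wloc (FwdDy i)) (\<lambda>i. wloc Alpha) (\<lambda>i. wloc (FwdD i j))
    (Arith (In (InY j)) Plus (In (InY j)) (wloc Alpha) (Return ())))))))))"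

text \<open>Only here is \<open>x\<close> formed, as \<open>C (D y) - b\<close>; during the
  iterations it exists only implicitly.\<close>

definition final_prog ::
    "nat \<Rightarrow> fact_result \<Rightarrow>
     (solver_input loc, (nat \<Rightarrow> solver_input loc) \<times> (nat \<Rightarrow> solver_input loc)) prog" where
  "final_prog n R =
    accumulate (wloc Tmp) (C_support n R)
      (\<lambda>e. wloc (Resid (fst e))) (\<lambda>e. cloc R (fst e) (snd e)) (\<lambda>e. wloc (Dy (snd e)))
    (accumulate (wloc Tmp) {..<n}
      (\<lambda>p. wloc (Resid p)) (\<lambda>p. wloc MinusOne) (\<lambda>p. In (InB p))
    (Return (\<lambda>p. wloc (Resid p), \<lambda>j. In (InY j))))"

definition setup_prog :: "nat \<Rightarrow> fact_result \<Rightarrow> solver" where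
  "setup_prog n R =
    LoadConst (wloc MinusOne) (- 1) (LoadConst (wloc MinusTwo) (- 2)
    (LoadConst (wloc MinusHalf) (- (1 / 2))
    (accumulate (wloc Tmp) (D_support n R)
      (\<lambda>e. wloc (Dy (fst e))) (\<lambda>e. dloc R (fst e) (snd e)) (\<lambda>e. In (InY (snd e)))
    (accumulate (wloc Tmp) (C_support n R)
      (\<lambda>e. wloc (Ctb (snd e))) (\<lambda>e. cloc R (fst e) (snd e)) (\<lambda>e. In (InB (fst e)))
    (accumulate (wloc Tmp) (D_support n R)
      (\<lambda>e. wloc (Colb (snd e))) (\<lambda>e. wloc (Ctb (fst e))) (\<lambda>e. dloc R (fst e) (snd e))
    (accumulate (wloc Tmp) (row_pairs n R)
      (\<lambda>e. wloc (Fwd (fst (snd e)) (snd (snd e))))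
      (\<lambda>e. cloc R (fst e) (fst (snd e))) (\<lambda>e. cloc R (fst e) (snd (snd e)))
    (accumulate (wloc Tmp) (strict_row_pairs n R)
      (\<lambda>e. wloc (Fwd (fst (snd e)) (snd (snd e))))
      (\<lambda>e. cloc R (fst e) (fst (snd e))) (\<lambda>e. cloc R (fst e) (snd (snd e)))
    (accumulate (wloc Tmp) (overlap n R)
      (\<lambda>e. wloc (FwdDy (fst e))) (\<lambda>e. wloc (Fwd (fst e) (snd e))) (\<lambda>e. wloc (Dy (snd e)))
    (accumulate (wloc Tmp) (overlap_column_pairs n R)
      (\<lambda>e. wloc (FwdD (fst e) (snd (snd e)))) (\<lambda>e. wloc (Fwd (fst e) (fst (snd e))))
      (\<lambda>e. dloc R (fst (snd e)) (snd (snd e)))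
    (accumulate (wloc Tmp) (D_support n R)
      (\<lambda>e. wloc (Colsq (snd e))) (\<lambda>e. dloc R (fst e) (snd e))
      (\<lambda>e. wloc (FwdD (fst e) (snd e)))
    (Return \<lparr>step_code = step_prog n R, final_code = final_prog n R\<rparr>)))))))))))"

section \<open>Evaluating accumulated sums, and counting by fibres\<close>

lemma added_other: "(\<And>e. e \<in> E \<Longrightarrow> z e \<noteq> l) \<Longrightarrow> added E z x y s l = s l"
  by (auto simp: added_def intro!: sum.neutral)

text \<open>Turns an accumulated sum into one over a full index range: \<open>h\<close> embeds the
  range into the index tuples, and a tuple missing from \<open>E\<close> does no harm because its
  mathematical term vanishes.\<close>

lemma added_eq_sum:
  assumes "finite J" and "inj_on h J"
    and "\<And>e. e \<in> E \<Longrightarrow> z e = l \<Longrightarrow> e \<in> h ` J"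
    and "\<And>j. j \<in> J \<Longrightarrow> h j \<in> E \<Longrightarrow> z (h j) = l \<and> s (x (h j)) * s (y (h j)) = g j"
    and "\<And>j. j \<in> J \<Longrightarrow> h j \<notin> E \<Longrightarrow> g j = 0"
  shows "added E z x y s l = s l + (\<Sum>j\<in>J. g j)"
proof -
  have "{e. e \<in> E \<and> z e = l} = h ` {j \<in> J. h j \<in> E}"
    using assms(3,4) by blast
  then have "(\<Sum>e | e \<in> E \<and> z e = l. s (x e) * s (y e)) =
      (\<Sum>j | j \<in> J \<and> h j \<in> E. s (x (h j)) * s (y (h j)))"
    using sum.reindex[of h "{j \<in> J. h j \<in> E}"] inj_on_subset[OF assms(2)] by auto
  also have "\<dots> = (\<Sum>j | j \<in> J \<and> h j \<in> E. g j)"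
    using assms(4) by (intro sum.cong) auto
  also have "\<dots> = (\<Sum>j\<in>J. g j)"
    using assms(1,5) by (intro sum.mono_neutral_left) auto
  finally show ?thesis unfolding added_def by simp
qed

lemma card_le_fibres:
  assumes "finite J" and "f ` E \<subseteq> J" and "\<And>j. j \<in> J \<Longrightarrow> card {e \<in> E. f e = j} \<le> k"
  shows "card E \<le> card J * k"
proof -
  have "E = (\<Union>j\<in>J. {e \<in> E. f e = j})" using assms(2) by auto
  then have "card E \<le> (\<Sum>j\<in>J. card {e \<in> E. f e = j})"
    using card_UN_le[OF assms(1), of "\<lambda>j. {e \<in> E. f e = j}"] by simp
  also have "\<dots> \<le> card J * k" using sum_bounded_above[of J _ k] assms(3) by simp
  finally show ?thesis .
qed

section \<open>Algebra and supports of a k-sparse factorization\<close>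

locale sparse_factors =
  fixes n k :: nat and R :: fact_result and C D :: "nat \<Rightarrow> nat \<Rightarrow> real" and b :: "nat \<Rightarrow> real"
  assumes C_zero: "(p, i) \<notin> C_support n R \<Longrightarrow> C p i = 0"
    and D_zero: "(i, j) \<notin> D_support n R \<Longrightarrow> D i j = 0"
    and C_column_nonempty: "i < width R \<Longrightarrow> \<exists>p. (p, i) \<in> C_support n R"
    and D_row_nonempty: "i < width R \<Longrightarrow> \<exists>j. (i, j) \<in> D_support n R"
    and card_reach: "j < n \<Longrightarrow> card (reach n R j) \<le> k"
    and n_pos: "1 \<le> n" and k_pos: "1 \<le> k"
begin

abbreviation "m \<equiv> width R"

definition gram :: "nat \<Rightarrow> nat \<Rightarrow> real" where
  "gram i' i = (\<Sum>p<n. C p i' * C p i)"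

text \<open>The matrix \<open>L\<close>. Its two summands match the two accumulation passes over
  \<open>row_pairs\<close> and \<open>strict_row_pairs\<close>.\<close>

definition fwd :: "nat \<Rightarrow> nat \<Rightarrow> real" where
  "fwd i' i = (if i \<le> i' then gram i' i else 0) + (if i < i' then gram i' i else 0)"

definition fwd_mult :: "(nat \<Rightarrow> real) \<Rightarrow> nat \<Rightarrow> real" where
  "fwd_mult u i' = (\<Sum>i<m. fwd i' i * u i)"

definition dmult :: "(nat \<Rightarrow> real) \<Rightarrow> nat \<Rightarrow> real" where
  "dmult y i = (\<Sum>j<n. D i j * y j)"

definition cmult :: "(nat \<Rightarrow> real) \<Rightarrow> nat \<Rightarrow> real" where
  "cmult u p = (\<Sum>i<m. C p i * u i)"

abbreviation dcol :: "nat \<Rightarrow> nat \<Rightarrow> real" where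
  "dcol j i \<equiv> D i j"

text \<open>In matrix form:
  \<open>u^T L v + (L u)^T v = u^T (L + L^T) v = 2 (C u)^T (C v)\<close>.\<close>

lemma fwd_mult_symmetrized:
  "(\<Sum>i<m. u i * fwd_mult v i) + (\<Sum>i<m. fwd_mult u i * v i) = 2 * (\<Sum>p<n. cmult u p * cmult v p)"
proof -
  have sym: "fwd i i' + fwd i' i = 2 * gram i i'" for i i'
    by (cases i i' rule: linorder_cases) (auto simp: fwd_def gram_def mult.commute)
  have "(\<Sum>i<m. fwd_mult u i * v i) = (\<Sum>i<m. \<Sum>i'<m. fwd i i' * u i' * v i)"
    by (simp add: fwd_mult_def sum_distrib_right)
  also have "\<dots> = (\<Sum>i<m. \<Sum>i'<m. fwd i' i * u i * v i')" by (rule sum.swap)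
  finally have "(\<Sum>i<m. u i * fwd_mult v i) + (\<Sum>i<m. fwd_mult u i * v i) =
      (\<Sum>i<m. \<Sum>i'<m. u i * fwd i i' * v i' + fwd i' i * u i * v i')"
    by (simp add: fwd_mult_def sum_distrib_left sum.distrib mult.assoc)
  also have "\<dots> = (\<Sum>i<m. \<Sum>i'<m. (fwd i i' + fwd i' i) * (u i * v i'))"
    by (intro sum.cong refl) (simp add: algebra_simps)
  also have "\<dots> = (\<Sum>i<m. \<Sum>i'<m. \<Sum>p<n. 2 * (C p i * u i) * (C p i' * v i'))"
    by (simp add: sym gram_def sum_distrib_left sum_distrib_right mult_ac)
  also have "\<dots> = (\<Sum>p<n. \<Sum>i<m. \<Sum>i'<m. 2 * (C p i * u i) * (C p i' * v i'))"
    by (subst sum.swap[of _ "{..<n}"], subst sum.swap[of _ "{..<n}" "{..<m}"]) (rule refl)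
  also have "\<dots> = 2 * (\<Sum>p<n. cmult u p * cmult v p)"
    unfolding cmult_def sum_product by (simp add: sum_distrib_left mult.assoc)
  finally show ?thesis .
qed

lemma finite_supports:
  "finite (C_support n R)" "finite (D_support n R)" "finite (overlap n R)"
  "finite (reach n R j)" "finite (D_column n R j)" "finite (row_pairs n R)"
  "finite (strict_row_pairs n R)" "finite (overlap_column_pairs n R)"
proof -
  have "C_support n R \<subseteq> {..<n} \<times> {..<m}" by (auto simp: C_support_def)
  then show C: "finite (C_support n R)" by (rule finite_subset) simp
  have "D_support n R \<subseteq> {..<m} \<times> {..<n}" by (auto simp: D_support_def)
  then show "finite (D_support n R)" by (rule finite_subset) simp
  have "overlap n R \<subseteq> {..<m} \<times> {..<m}" by (auto simp: overlap_def C_support_def)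
  then show "finite (overlap n R)" by (rule finite_subset) simp
  have "reach n R j \<subseteq> {..<m}" by (auto simp: reach_def overlap_def C_support_def)
  then show "finite (reach n R j)" by (rule finite_subset) simp
  have "D_column n R j \<subseteq> {..<m}" by (auto simp: D_column_def D_support_def)
  then show "finite (D_column n R j)" by (rule finite_subset) simp
  have "row_pairs n R \<subseteq> {..<n} \<times> {..<m} \<times> {..<m}" by (auto simp: row_pairs_def C_support_def)
  then show "finite (row_pairs n R)" by (rule finite_subset) simp
  then show "finite (strict_row_pairs n R)"
    by (rule rev_finite_subset) (auto simp: strict_row_pairs_def)
  have "overlap_column_pairs n R \<subseteq> {..<m} \<times> {..<m} \<times> {..<n}"
    by (auto simp: overlap_column_pairs_def overlap_def C_support_def D_support_def)
  then show "finite (overlap_column_pairs n R)" by (rule finite_subset) simp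
qed

lemma fwd_zero: "(i', i) \<notin> overlap n R \<Longrightarrow> fwd i' i = 0"
proof -
  assume "(i', i) \<notin> overlap n R"
  then have "i \<le> i' \<Longrightarrow> gram i' i = 0"
    unfolding gram_def overlap_def by (intro sum.neutral) (auto intro: C_zero)
  then show "fwd i' i = 0" unfolding fwd_def by auto
qed

lemma cmult_dmult: "cmult (dmult y) p = (\<Sum>j<n. cmult (dcol j) p * y j)"
proof -
  have "cmult (dmult y) p = (\<Sum>i<m. \<Sum>j<n. C p i * D i j * y j)"
    by (simp add: cmult_def dmult_def sum_distrib_left mult.assoc)
  also have "\<dots> = (\<Sum>j<n. \<Sum>i<m. C p i * D i j * y j)" by (rule sum.swap)
  finally show ?thesis by (simp add: cmult_def sum_distrib_right)
qed

definition sound :: "(solver_input loc \<Rightarrow> real) \<Rightarrow> bool" where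
  "sound s \<longleftrightarrow> s (wloc Tmp) = 0 \<and>
     (\<forall>p i. (p, i) \<in> C_support n R \<longrightarrow> s (cloc R p i) = C p i) \<and>
     (\<forall>i j. (i, j) \<in> D_support n R \<longrightarrow> s (dloc R i j) = D i j) \<and>
     (\<forall>p<n. s (In (InB p)) = b p)"

text \<open>The invariant between iterations. \<open>Resid\<close> must still be zero because the
  final code adds into it, and \<open>Tmp\<close> (through \<open>sound\<close>) because each
  product sum starts from a cleared scratch location.\<close>

definition ready :: "(solver_input loc \<Rightarrow> real) \<Rightarrow> (nat \<Rightarrow> real) \<Rightarrow> bool" where
  "ready s y \<longleftrightarrow> sound s \<and> s (wloc MinusOne) = - 1 \<and> s (wloc MinusTwo) = - 2 \<and>
     s (wloc MinusHalf) = - 1 / 2 \<and> (\<forall>p. s (wloc (Resid p)) = 0) \<and>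
     (\<forall>i<m. s (wloc (Dy i)) = dmult y i) \<and>
     (\<forall>i<m. s (wloc (FwdDy i)) = fwd_mult (dmult y) i) \<and>
     (\<forall>i<m. \<forall>j<n. s (wloc (FwdD i j)) = fwd_mult (dcol j) i) \<and>
     (\<forall>j<n. s (wloc (Colb j)) = (\<Sum>p<n. b p * cmult (dcol j) p)) \<and>
     (\<forall>j<n. s (wloc (Colsq j)) = (\<Sum>p<n. cmult (dcol j) p * cmult (dcol j) p)) \<and>
     (\<forall>j<n. s (In (InY j)) = y j)"

definition residual :: "(nat \<Rightarrow> real) \<Rightarrow> nat \<Rightarrow> real" where
  "residual y p = cmult (dmult y) p - b p"

text \<open>A zero column gives the quotient zero here, in the program and in
  \<open>iteration_step\<close> alike, so no case distinction on it arises.\<close>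

definition step_size :: "(nat \<Rightarrow> real) \<Rightarrow> nat \<Rightarrow> real" where
  "step_size y j = (\<Sum>p<n. residual y p * cmult (dcol j) p) /
     (\<Sum>p<n. cmult (dcol j) p * cmult (dcol j) p)"

text \<open>A nonempty column of \<open>C\<close> meets itself, so each index belongs to its own
  forward overlap. Thus \<open>k\<close> also bounds the columns of \<open>D\<close>.\<close>

lemma D_column_subset_reach: "D_column n R j \<subseteq> reach n R j"
proof
  fix i assume "i \<in> D_column n R j"
  then have i: "(i, j) \<in> D_support n R" "i < m" by (auto simp: D_column_def D_support_def)
  then show "i \<in> reach n R j"
    using C_column_nonempty[OF i(2)] by (auto simp: reach_def overlap_def)
qed

lemma card_D_column: "j < n \<Longrightarrow> card (D_column n R j) \<le> k"
  using card_mono[OF finite_supports(4) D_column_subset_reach] card_reach le_trans by blast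

section \<open>Effect and cost of the step, setup and final code\<close>

lemma exec_step:
  assumes "ready s y" and j: "j < n"
  shows "\<exists>s' t. exec (step_prog n R j) s = ((), s', t) \<and> t \<le> 19 * k \<and>
    ready s' (y(j := y j - step_size y j))"
proof -
  note fin = finite_supports
  have rd: "sound s" "s (wloc MinusOne) = - 1" "s (wloc MinusTwo) = - 2"
     "s (wloc MinusHalf) = - 1 / 2" "\<And>p. s (wloc (Resid p)) = 0"
     "\<And>i. i < m \<Longrightarrow> s (wloc (Dy i)) = dmult y i"
     "\<And>i. i < m \<Longrightarrow> s (wloc (FwdDy i)) = fwd_mult (dmult y) i"
     "\<And>i j. i < m \<Longrightarrow> j < n \<Longrightarrow> s (wloc (FwdD i j)) = fwd_mult (dcol j) i"
     "\<And>j. j < n \<Longrightarrow> s (wloc (Colb j)) = (\<Sum>p<n. b p * cmult (dcol j) p)"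
     "\<And>j. j < n \<Longrightarrow> s (wloc (Colsq j)) = (\<Sum>p<n. cmult (dcol j) p * cmult (dcol j) p)"
     "\<And>j. j < n \<Longrightarrow> s (In (InY j)) = y j"
    and snd: "s (wloc Tmp) = 0"
     "\<And>p i. (p, i) \<in> C_support n R \<Longrightarrow> s (cloc R p i) = C p i"
     "\<And>i j. (i, j) \<in> D_support n R \<Longrightarrow> s (dloc R i j) = D i j"
     "\<And>p. p < n \<Longrightarrow> s (In (InB p)) = b p"
    using assms(1) unfolding ready_def sound_def by auto
  \<comment> \<open>With this and \<open>dcol_zero\<close>, the sums over \<open>reach\<close> and
    \<open>D_column\<close> equal sums over all \<open>i < m\<close>, to which the algebra
    applies.\<close>
  have fwd_dcol_zero: "fwd_mult (dcol j) i = 0" if "i \<notin> reach n R j" for i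
    unfolding fwd_mult_def
  proof (intro sum.neutral ballI)
    fix i' assume "i' \<in> {..<m}"
    have "(i, i') \<notin> overlap n R \<or> (i', j) \<notin> D_support n R"
      using that by (auto simp: reach_def)
    then show "fwd i i' * D i' j = 0" using fwd_zero D_zero by auto
  qed
  have dcol_zero: "D i j = 0" if "i \<notin> D_column n R j" for i
    using that D_zero by (auto simp: D_column_def)
  have reach_lt: "i < m" if "i \<in> reach n R j" for i
    using that by (auto simp: reach_def overlap_def C_support_def)
  have dcol_D: "(i, j) \<in> D_support n R" "i < m" if "i \<in> D_column n R j" for i
    using that by (auto simp: D_column_def D_support_def)
  \<comment> \<open>\<open>s1\<close> to \<open>s9\<close> are the stores after the successive
    instructions of \<open>step_prog\<close>.\<close>
  define s1 where "s1 = s(wloc Alpha := 0)"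
  define s2 where "s2 = added (reach n R j) (\<lambda>i. wloc Alpha) (\<lambda>i. wloc (Dy i))
    (\<lambda>i. wloc (FwdD i j)) s1"
  define s3 where "s3 = added (D_column n R j) (\<lambda>i. wloc Alpha) (\<lambda>i. wloc (FwdDy i))
    (\<lambda>i. dloc R i j) s2"
  define s4 where "s4 = added {()} (\<lambda>_. wloc Alpha) (\<lambda>_. wloc MinusTwo) (\<lambda>_. wloc (Colb j)) s3"
  define s5 where "s5 = s4(wloc Alpha := s4 (wloc Alpha) / s4 (wloc (Colsq j)))"
  define s6 where "s6 = s5(wloc Alpha := s5 (wloc Alpha) * s5 (wloc MinusHalf))"
  define s7 where "s7 = added (D_column n R j) (\<lambda>i. wloc (Dy i)) (\<lambda>i. wloc Alpha)
    (\<lambda>i. dloc R i j) s6"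
  define s8 where "s8 = added (reach n R j) (\<lambda>i. wloc (FwdDy i)) (\<lambda>i. wloc Alpha)
    (\<lambda>i. wloc (FwdD i j)) s7"
  define s9 where "s9 = s8(In (InY j) := s8 (In (InY j)) + s8 (wloc Alpha))"
  have o4: "s4 l = s l" if "l \<noteq> wloc Alpha" for l
    using that by (simp add: s4_def s3_def s2_def s1_def added_other)
  have tmp: "s1 (wloc Tmp) = 0" "s2 (wloc Tmp) = 0" "s3 (wloc Tmp) = 0" "s6 (wloc Tmp) = 0"
      "s7 (wloc Tmp) = 0"
    using snd(1) by (simp_all add: s7_def s6_def s5_def s4_def s3_def s2_def s1_def added_other)
  \<comment> \<open>The 7 consists of four single operations and the three of the one-term sum. The
    other four sums visit each of the two index sets twice, at three operations per index.\<close>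
  have ex: "exec (step_prog n R j) s =
      ((), s9, 7 + 6 * card (reach n R j) + 6 * card (D_column n R j))"
    unfolding step_prog_def
    by (simp add: exec_accumulate fin tmp
        flip: s1_def s2_def s3_def s4_def s5_def s6_def s7_def s8_def s9_def)
  have a2: "s2 (wloc Alpha) = (\<Sum>i<m. dmult y i * fwd_mult (dcol j) i)"
    unfolding s2_def
    by (subst added_eq_sum[where J = "{..<m}" and h = "\<lambda>i. i" and
          g = "\<lambda>i. dmult y i * fwd_mult (dcol j) i"])
      (auto simp: s1_def rd j fwd_dcol_zero reach_lt)
  have a3: "s3 (wloc Alpha) = s2 (wloc Alpha) + (\<Sum>i<m. fwd_mult (dmult y) i * D i j)"
    unfolding s3_def
    by (rule added_eq_sum[where h = "\<lambda>i. i"])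
      (auto simp: s1_def s2_def added_other rd snd dcol_D dcol_zero)
  have a4: "s4 (wloc Alpha) = s3 (wloc Alpha) - 2 * (\<Sum>p<n. b p * cmult (dcol j) p)"
    unfolding s4_def by (simp add: added_def[of "{()}"])
      (simp add: s1_def s2_def s3_def added_other rd j)
  \<comment> \<open>Symmetrization with \<open>u = D y\<close> and \<open>v = d_j\<close> yields
    \<open>2 (A y)^T q_j\<close>, and the \<open>Colb\<close> term supplies
    \<open>- 2 b^T q_j\<close>.\<close>
  have "s4 (wloc Alpha) = 2 * (\<Sum>p<n. residual y p * cmult (dcol j) p)"
    unfolding a4 a3 a2 using fwd_mult_symmetrized[of "dmult y" "dcol j"]
    by (simp add: residual_def left_diff_distrib sum_subtractf)
  moreover have "s6 (wloc Alpha) = s4 (wloc Alpha) / s4 (wloc (Colsq j)) * s4 (wloc MinusHalf)"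
    by (simp add: s6_def s5_def)
  ultimately have a6: "s6 (wloc Alpha) = - step_size y j"
    by (simp add: o4 rd j step_size_def)
  have o6: "s6 l = s l" if "l \<noteq> wloc Alpha" for l
    using that by (simp add: s6_def s5_def o4)
  let ?y = "y(j := y j - step_size y j)"
  have dm: "dmult ?y i = dmult y i - step_size y j * D i j" for i
  proof -
    have "dmult ?y i = (\<Sum>j'<n. D i j' * y j' - (if j' = j then step_size y j * D i j else 0))"
      unfolding dmult_def by (intro sum.cong) (auto simp: algebra_simps)
    then show ?thesis using j by (simp add: dmult_def sum_subtractf)
  qed
  have fm: "fwd_mult (dmult ?y) i = fwd_mult (dmult y) i - step_size y j * fwd_mult (dcol j) i" for i
    by (simp add: fwd_mult_def dm algebra_simps sum_subtractf sum_distrib_left)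
  have d7: "s7 (wloc (Dy i)) = dmult ?y i" if "i < m" for i
    unfolding s7_def
    by (subst added_eq_sum[where J = "{i}" and h = "\<lambda>i. i" and
          g = "\<lambda>i. - (step_size y j * D i j)"])
      (auto simp: o6 a6 rd snd dcol_D dcol_zero dm that)
  have d8: "s8 (wloc (FwdDy i)) = fwd_mult (dmult ?y) i" if "i < m" for i
    unfolding s8_def
    by (subst added_eq_sum[where J = "{i}" and h = "\<lambda>i. i" and
          g = "\<lambda>i. - (step_size y j * fwd_mult (dcol j) i)"])
      (auto simp: s7_def added_other o6 a6 rd snd j fwd_dcol_zero fm that)
  have o9: "s9 l = s l" if "l \<noteq> wloc Alpha" "\<And>i. l \<noteq> wloc (Dy i)" "\<And>i. l \<noteq> wloc (FwdDy i)"
      "l \<noteq> In (InY j)" for l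
  proof -
    have "s9 l = s6 l" using that(2,3)[symmetric] that(4)
      by (simp add: s9_def s8_def s7_def added_other)
    then show ?thesis using o6 that(1) by simp
  qed
  have "s9 (wloc (Dy i)) = dmult ?y i" if "i < m" for i
    using d7 that by (simp add: s9_def s8_def added_other)
  moreover have "s9 (wloc (FwdDy i)) = fwd_mult (dmult ?y) i" if "i < m" for i
    using d8 that by (simp add: s9_def)
  moreover have "s9 (In (InY j)) = y j - step_size y j"
    using a6 by (simp add: s9_def s8_def s7_def added_other o6 rd j)
  ultimately have "ready s9 ?y"
    unfolding ready_def sound_def using rd snd by (auto simp: o9)
  moreover have "7 + 6 * card (reach n R j) + 6 * card (D_column n R j) \<le> 19 * k"
    using card_reach[OF j] card_D_column[OF j] k_pos by linarith
  ultimately show ?thesis using ex by blast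
qed

text \<open>The 9 comes from three passes over \<open>D_support\<close>, for \<open>Dy\<close>,
  \<open>Colb\<close> and \<open>Colsq\<close>; the leading 3 loads the constants.\<close>

lemma exec_setup:
  assumes "sound s" and zero: "\<And>w. s (wloc w) = 0" and y: "\<And>j. j < n \<Longrightarrow> s (In (InY j)) = y j"
  shows "\<exists>s'. exec (setup_prog n R) s =
      (\<lparr>step_code = step_prog n R, final_code = final_prog n R\<rparr>, s',
       3 + 9 * card (D_support n R) + 3 * card (C_support n R) + 3 * card (row_pairs n R) +
       3 * card (strict_row_pairs n R) + 3 * card (overlap n R) +
       3 * card (overlap_column_pairs n R)) \<and> ready s' y"
proof -
  note fin = finite_supports
  have snd: "s (wloc Tmp) = 0"
     "\<And>p i. (p, i) \<in> C_support n R \<Longrightarrow> s (cloc R p i) = C p i"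
     "\<And>i j. (i, j) \<in> D_support n R \<Longrightarrow> s (dloc R i j) = D i j"
     "\<And>p. p < n \<Longrightarrow> s (In (InB p)) = b p"
    using assms(1) unfolding sound_def by auto
  have C_lt: "p < n" "i < m" if "(p, i) \<in> C_support n R" for p i
    using that by (auto simp: C_support_def)
  have D_lt: "i < m" "j < n" if "(i, j) \<in> D_support n R" for i j
    using that by (auto simp: D_support_def)
  have overlap_lt: "i' < m" "i < m" if "(i', i) \<in> overlap n R" for i i'
    using that by (auto simp: overlap_def C_support_def)
  define s0 where "s0 = s(wloc MinusOne := - 1, wloc MinusTwo := - 2, wloc MinusHalf := - (1 / 2))"
  define s1 where "s1 = added (D_support n R)
    (\<lambda>e. wloc (Dy (fst e))) (\<lambda>e. dloc R (fst e) (snd e)) (\<lambda>e. In (InY (snd e))) s0"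
  define s2 where "s2 = added (C_support n R)
    (\<lambda>e. wloc (Ctb (snd e))) (\<lambda>e. cloc R (fst e) (snd e)) (\<lambda>e. In (InB (fst e))) s1"
  define s3 where "s3 = added (D_support n R)
    (\<lambda>e. wloc (Colb (snd e))) (\<lambda>e. wloc (Ctb (fst e))) (\<lambda>e. dloc R (fst e) (snd e)) s2"
  define s4 where "s4 = added (row_pairs n R)
    (\<lambda>e. wloc (Fwd (fst (snd e)) (snd (snd e))))
    (\<lambda>e. cloc R (fst e) (fst (snd e))) (\<lambda>e. cloc R (fst e) (snd (snd e))) s3"
  define s5 where "s5 = added (strict_row_pairs n R)
    (\<lambda>e. wloc (Fwd (fst (snd e)) (snd (snd e))))
    (\<lambda>e. cloc R (fst e) (fst (snd e))) (\<lambda>e. cloc R (fst e) (snd (snd e))) s4"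
  define s6 where "s6 = added (overlap n R)
    (\<lambda>e. wloc (FwdDy (fst e))) (\<lambda>e. wloc (Fwd (fst e) (snd e))) (\<lambda>e. wloc (Dy (snd e))) s5"
  define s7 where "s7 = added (overlap_column_pairs n R)
    (\<lambda>e. wloc (FwdD (fst e) (snd (snd e)))) (\<lambda>e. wloc (Fwd (fst e) (fst (snd e))))
    (\<lambda>e. dloc R (fst (snd e)) (snd (snd e))) s6"
  define s8 where "s8 = added (D_support n R)
    (\<lambda>e. wloc (Colsq (snd e))) (\<lambda>e. dloc R (fst e) (snd e))
    (\<lambda>e. wloc (FwdD (fst e) (snd e))) s7"
  note defs = s1_def s2_def s3_def s4_def s5_def s6_def s7_def s8_def
  have s0: "s0 (wloc w) = (case w of MinusOne \<Rightarrow> - 1 | MinusTwo \<Rightarrow> - 2 | MinusHalf \<Rightarrow> - 1 / 2 | _ \<Rightarrow> 0)"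
    "s0 (cloc R p i) = s (cloc R p i)" "s0 (dloc R i j) = s (dloc R i j)" "s0 (In a) = s (In a)"
    for w p i j a
    by (auto simp: s0_def zero split: work.splits)
  have tmp: "s0 (wloc Tmp) = 0" "s1 (wloc Tmp) = 0" "s2 (wloc Tmp) = 0" "s3 (wloc Tmp) = 0"
      "s4 (wloc Tmp) = 0" "s5 (wloc Tmp) = 0" "s6 (wloc Tmp) = 0" "s7 (wloc Tmp) = 0"
    by (simp_all add: defs added_other s0)
  have ex: "exec (setup_prog n R) s =
      (\<lparr>step_code = step_prog n R, final_code = final_prog n R\<rparr>, s8,
       3 + 9 * card (D_support n R) + 3 * card (C_support n R) + 3 * card (row_pairs n R) +
       3 * card (strict_row_pairs n R) + 3 * card (overlap n R) +
       3 * card (overlap_column_pairs n R))"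
    unfolding setup_prog_def
    by (simp add: exec_accumulate fin tmp
        flip: s0_def s1_def s2_def s3_def s4_def s5_def s6_def s7_def s8_def)
  have v1: "s1 (wloc (Dy i)) = dmult y i" if "i < m" for i
    unfolding s1_def dmult_def
    by (subst added_eq_sum[where J = "{..<n}" and h = "\<lambda>j. (i, j)" and g = "\<lambda>j. D i j * y j"])
      (auto simp: inj_on_def s0 snd y D_zero dest: D_lt)
  have v2: "s2 (wloc (Ctb i)) = (\<Sum>p<n. C p i * b p)" if "i < m" for i
    unfolding s2_def
    by (subst added_eq_sum[where J = "{..<n}" and h = "\<lambda>p. (p, i)" and g = "\<lambda>p. C p i * b p"])
      (auto simp: inj_on_def s1_def added_other s0 snd C_zero dest: C_lt)
  have z2: "s2 (wloc (Colb j)) = 0" "(i, j) \<in> D_support n R \<Longrightarrow> s2 (dloc R i j) = D i j" for i j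
    by (simp_all add: s2_def s1_def added_other s0 snd)
  \<comment> \<open>\<open>b^T q_j\<close> is computed as \<open>(C^T b)^T d_j\<close>, so that the
    column \<open>q_j\<close> itself is never formed.\<close>
  have "(\<Sum>i<m. (\<Sum>p<n. C p i * b p) * D i j) = (\<Sum>p<n. b p * cmult (dcol j) p)" for j
    unfolding cmult_def sum_distrib_left sum_distrib_right
    by (subst sum.swap) (simp add: mult_ac)
  moreover have "s3 (wloc (Colb j)) = (\<Sum>i<m. (\<Sum>p<n. C p i * b p) * D i j)" if "j < n" for j
    unfolding s3_def
    by (subst added_eq_sum[where J = "{..<m}" and h = "\<lambda>i. (i, j)" and
          g = "\<lambda>i. (\<Sum>p<n. C p i * b p) * D i j"])
      (auto simp: inj_on_def v2 z2 D_zero that dest: D_lt)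
  ultimately have v3: "s3 (wloc (Colb j)) = (\<Sum>p<n. b p * cmult (dcol j) p)" if "j < n" for j
    using that by simp
  have z3: "s3 (wloc (Fwd i' i)) = 0" "(p, i) \<in> C_support n R \<Longrightarrow> s3 (cloc R p i) = C p i" for i i' p
    by (simp_all add: s3_def s2_def s1_def added_other s0 snd)
  have z4: "(p, i) \<in> C_support n R \<Longrightarrow> s4 (cloc R p i) = C p i" for i p
    by (simp add: s4_def added_other z3)
  have C_mult_zero: "C p i' * C p i = 0" if "\<not> ((p, i') \<in> C_support n R \<and> (p, i) \<in> C_support n R)"
    for p i i'
    using that C_zero by auto
  have v4: "s4 (wloc (Fwd i' i)) = (if i \<le> i' then gram i' i else 0)" if "i < m" "i' < m" for i i'
  proof -
    have "s4 (wloc (Fwd i' i)) = 0 + (\<Sum>p<n. if i \<le> i' then C p i' * C p i else 0)"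
      unfolding s4_def
      by (subst added_eq_sum[where J = "{..<n}" and h = "\<lambda>p. (p, i', i)" and
            g = "\<lambda>p. if i \<le> i' then C p i' * C p i else 0"])
        (auto simp: inj_on_def z3 row_pairs_def C_lt simp del: mult_eq_0_iff intro!: C_mult_zero)
    then show ?thesis by (simp add: gram_def)
  qed
  have v5: "s5 (wloc (Fwd i' i)) = fwd i' i" if "i < m" "i' < m" for i i'
  proof -
    have "s5 (wloc (Fwd i' i)) = s4 (wloc (Fwd i' i)) +
        (\<Sum>p<n. if i < i' then C p i' * C p i else 0)"
      unfolding s5_def
      by (subst added_eq_sum[where J = "{..<n}" and h = "\<lambda>p. (p, i', i)" and
            g = "\<lambda>p. if i < i' then C p i' * C p i else 0"])
        (auto simp: inj_on_def z4 row_pairs_def strict_row_pairs_def C_lt simp del: mult_eq_0_iff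
          intro!: C_mult_zero)
    then show ?thesis by (simp add: v4 that fwd_def gram_def)
  qed
  have o5: "s5 l = s1 l" if "\<And>i i'. l \<noteq> wloc (Fwd i i')" "\<And>i. l \<noteq> wloc (Ctb i)"
      "\<And>j. l \<noteq> wloc (Colb j)" for l
    using that[symmetric] by (simp add: s5_def s4_def s3_def s2_def added_other)
  have z5: "s5 (wloc (Dy i)) = dmult y i" "s5 (wloc (FwdDy i)) = 0" if "i < m" for i
    using v1[OF that] by (simp_all add: o5 s1_def added_other s0)
  have v6: "s6 (wloc (FwdDy i)) = fwd_mult (dmult y) i" if "i < m" for i
    unfolding s6_def fwd_mult_def
    by (subst added_eq_sum[where J = "{..<m}" and h = "\<lambda>i'. (i, i')" and
          g = "\<lambda>i'. fwd i i' * dmult y i'"])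
      (auto simp: inj_on_def v5 z5 that fwd_zero dest: overlap_lt)
  have z6: "s6 (wloc (FwdD i j)) = 0" "(i, j) \<in> D_support n R \<Longrightarrow> s6 (dloc R i j) = D i j"
    "i < m \<Longrightarrow> i' < m \<Longrightarrow> s6 (wloc (Fwd i' i)) = fwd i' i" for i j i'
    by (simp_all add: s6_def added_other v5) (simp_all add: o5 s1_def added_other s0 snd)
  have v7: "s7 (wloc (FwdD i j)) = fwd_mult (dcol j) i" if "i < m" "j < n" for i j
    unfolding s7_def fwd_mult_def
    by (subst added_eq_sum[where J = "{..<m}" and h = "\<lambda>i'. (i, i', j)" and
          g = "\<lambda>i'. fwd i i' * D i' j"])
      (auto simp: inj_on_def z6 that overlap_column_pairs_def dest: D_lt overlap_lt
        intro: fwd_zero D_zero)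
  have z7: "s7 (wloc (Colsq j)) = 0" "(i, j) \<in> D_support n R \<Longrightarrow> s7 (dloc R i j) = D i j" for i j
    by (simp_all add: s7_def s6_def added_other o5 s1_def s0 snd)
  \<comment> \<open>\<open>q_j^T q_j = d_j^T L d_j\<close>: with equal arguments both one-sided
    products of the symmetrization coincide.\<close>
  have v8: "s8 (wloc (Colsq j)) = (\<Sum>p<n. cmult (dcol j) p * cmult (dcol j) p)" if "j < n" for j
  proof -
    have "s8 (wloc (Colsq j)) = 0 + (\<Sum>i<m. D i j * fwd_mult (dcol j) i)"
      unfolding s8_def
      by (subst added_eq_sum[where J = "{..<m}" and h = "\<lambda>i. (i, j)" and
            g = "\<lambda>i. D i j * fwd_mult (dcol j) i"])
        (auto simp: inj_on_def v7 z7 that D_zero dest: D_lt)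
    then show ?thesis
      using fwd_mult_symmetrized[of "dcol j" "dcol j"] by (simp add: mult.commute)
  qed
  have o8: "s8 l = s0 l" if "\<And>i i'. l \<noteq> wloc (Fwd i i')" "\<And>i. l \<noteq> wloc (Ctb i)"
      "\<And>j. l \<noteq> wloc (Colb j)" "\<And>i. l \<noteq> wloc (Dy i)" "\<And>i. l \<noteq> wloc (FwdDy i)"
      "\<And>i j. l \<noteq> wloc (FwdD i j)" "\<And>j. l \<noteq> wloc (Colsq j)" for l
    using that[symmetric] by (simp add: defs added_other)
  have "s8 (wloc (Dy i)) = dmult y i" if "i < m" for i
    using z5(1)[OF that] by (simp add: s8_def s7_def s6_def added_other)
  moreover have "s8 (wloc (FwdDy i)) = fwd_mult (dmult y) i" if "i < m" for i
    using v6[OF that] by (simp add: s8_def s7_def added_other)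
  moreover have "s8 (wloc (FwdD i j)) = fwd_mult (dcol j) i" if "i < m" "j < n" for i j
    using v7[OF that] by (simp add: s8_def added_other)
  moreover have "s8 (wloc (Colb j)) = (\<Sum>p<n. b p * cmult (dcol j) p)" if "j < n" for j
    using v3[OF that] by (simp add: s8_def s7_def s6_def s5_def s4_def added_other)
  ultimately have "ready s8 y"
    unfolding ready_def sound_def using snd y v8 by (auto simp: o8 s0)
  then show ?thesis using ex by blast
qed

lemma exec_final:
  assumes "ready s y"
  shows "\<exists>s'. exec (final_prog n R) s =
      ((\<lambda>p. wloc (Resid p), \<lambda>j. In (InY j)), s', 3 * card (C_support n R) + 3 * n) \<and>
    (\<forall>p<n. s' (wloc (Resid p)) = residual y p) \<and> (\<forall>j<n. s' (In (InY j)) = y j)"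
proof -
  have rd: "s (wloc MinusOne) = - 1" "\<And>p. s (wloc (Resid p)) = 0"
     "\<And>i. i < m \<Longrightarrow> s (wloc (Dy i)) = dmult y i"
     "\<And>j. j < n \<Longrightarrow> s (In (InY j)) = y j"
     "s (wloc Tmp) = 0"
     "\<And>p i. (p, i) \<in> C_support n R \<Longrightarrow> s (cloc R p i) = C p i"
     "\<And>p. p < n \<Longrightarrow> s (In (InB p)) = b p"
    using assms unfolding ready_def sound_def by auto
  have C_lt: "p < n" "i < m" if "(p, i) \<in> C_support n R" for p i
    using that by (auto simp: C_support_def)
  define s1 where "s1 = added (C_support n R)
      (\<lambda>e. wloc (Resid (fst e))) (\<lambda>e. cloc R (fst e) (snd e)) (\<lambda>e. wloc (Dy (snd e))) s"
  define s2 where "s2 = added {..<n}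
      (\<lambda>p. wloc (Resid p)) (\<lambda>p. wloc MinusOne) (\<lambda>p. In (InB p)) s1"
  have tmp: "s1 (wloc Tmp) = 0" by (simp add: s1_def added_other rd)
  have ex: "exec (final_prog n R) s =
      ((\<lambda>p. wloc (Resid p), \<lambda>j. In (InY j)), s2, 3 * card (C_support n R) + 3 * n)"
    unfolding final_prog_def
    by (simp add: exec_accumulate finite_supports tmp rd flip: s1_def s2_def)
  have "s1 (wloc (Resid p)) = cmult (dmult y) p" if "p < n" for p
    unfolding s1_def cmult_def
    by (subst added_eq_sum[where J = "{..<m}" and h = "\<lambda>i. (p, i)" and
          g = "\<lambda>i. C p i * dmult y i"])
      (auto simp: inj_on_def rd C_zero dest: C_lt)
  moreover have "s1 (wloc MinusOne) = - 1" by (simp add: s1_def added_other rd)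
  moreover have "s1 (In (InB p)) = b p" if "p < n" for p
    using that by (simp add: s1_def added_other rd)
  ultimately have "s2 (wloc (Resid p)) = residual y p" if "p < n" for p
    unfolding s2_def residual_def
    by (subst added_eq_sum[where J = "{p}" and h = "\<lambda>p. p" and g = "\<lambda>p. - b p"])
      (auto simp: that)
  moreover have "s2 (In (InY j)) = y j" if "j < n" for j
    using that by (simp add: s2_def s1_def added_other rd)
  ultimately show ?thesis using ex by blast
qed

text \<open>The iteration on \<open>y\<close> alone suffices as a model, since \<open>x\<close> is
  always the residual of \<open>y\<close>.\<close>

definition improve :: "nat \<Rightarrow> (nat \<Rightarrow> real) \<Rightarrow> nat \<Rightarrow> real" where
  "improve j y = y(j := y j - step_size y j)"

lemma exec_all_steps:
  assumes "ready s y" and "set picks \<subseteq> {..<n}"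
  shows "\<exists>s' t. exec_steps (step_prog n R) picks s = (s', t) \<and> t \<le> 19 * k * length picks \<and>
    ready s' (fold improve picks y)"
  using assms
proof (induction picks arbitrary: s y)
  case (Cons j picks)
  obtain s1 t1 where 1: "exec (step_prog n R j) s = ((), s1, t1)" "t1 \<le> 19 * k"
      "ready s1 (improve j y)"
    using exec_step[of s y j] Cons.prems unfolding improve_def by auto
  obtain s2 t2 where 2: "exec_steps (step_prog n R) picks s1 = (s2, t2)"
      "t2 \<le> 19 * k * length picks" "ready s2 (fold improve picks (improve j y))"
    using Cons.IH[OF 1(3)] Cons.prems by auto
  show ?case using 1 2 by auto
qed simp

text \<open>Each set is counted along a coordinate whose fibres have at most \<open>k\<close>
  elements: columns of \<open>D\<close>, rows of \<open>C\<close>, and columns of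
  \<open>overlap\<close>.\<close>

lemma cost_bounds:
  "card (D_support n R) \<le> n * k" "card (C_support n R) \<le> n * k"
  "card (row_pairs n R) \<le> n * k * k" "card (strict_row_pairs n R) \<le> n * k * k"
  "card (overlap n R) \<le> n * k * k" "card (overlap_column_pairs n R) \<le> n * k * k"
proof -
  \<comment> \<open>Row \<open>i\<close> of \<open>D\<close> is nonzero, so \<open>i\<close> lies in
    the support of some \<open>d_j\<close>, and \<open>reach\<close> of that \<open>j\<close>
    contains the whole forward overlap of \<open>i\<close>.\<close>
  have overlap_col: "card {i'. (i', i) \<in> overlap n R} \<le> k" for i
  proof (cases "i < m")
    case True
    then obtain j where j: "(i, j) \<in> D_support n R" using D_row_nonempty by blast
    then have "{i'. (i', i) \<in> overlap n R} \<subseteq> reach n R j" by (auto simp: reach_def)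
    then have "card {i'. (i', i) \<in> overlap n R} \<le> card (reach n R j)"
      by (intro card_mono finite_supports)
    also have "\<dots> \<le> k" using card_reach[of j] j by (simp add: D_support_def)
    finally show ?thesis .
  next
    case False
    then have "{i'. (i', i) \<in> overlap n R} = {}" by (auto simp: overlap_def C_support_def)
    then show ?thesis by simp
  qed
  have C_row: "card {i. (p, i) \<in> C_support n R} \<le> k" for p
  proof (cases "{i. (p, i) \<in> C_support n R} = {}")
    case False
    define i0 where "i0 = (LEAST i. (p, i) \<in> C_support n R)"
    have "(p, i0) \<in> C_support n R" unfolding i0_def using False by (auto intro: LeastI)
    moreover have "i0 \<le> i" if "(p, i) \<in> C_support n R" for i
      unfolding i0_def using that by (rule Least_le)
    ultimately have "{i. (p, i) \<in> C_support n R} \<subseteq> {i'. (i', i0) \<in> overlap n R}"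
      by (auto simp: overlap_def)
    moreover have "finite {i'. (i', i0) \<in> overlap n R}"
      by (rule finite_subset[of _ "{..<m}"]) (auto simp: overlap_def C_support_def)
    ultimately have "card {i. (p, i) \<in> C_support n R} \<le> card {i'. (i', i0) \<in> overlap n R}"
      by (intro card_mono)
    also have "\<dots> \<le> k" by (rule overlap_col)
    finally show ?thesis .
  next
    case True
    then show ?thesis by simp
  qed
  show D: "card (D_support n R) \<le> n * k"
  proof -
    have "card {e \<in> D_support n R. snd e = j} \<le> k" if "j < n" for j
    proof -
      have "{e \<in> D_support n R. snd e = j} = (\<lambda>i. (i, j)) ` D_column n R j"
        by (auto simp: D_column_def)
      then show ?thesis using card_D_column[OF that] card_image_le[OF finite_supports(5)]
        by (metis le_trans)
    qed
    moreover have "snd ` D_support n R \<subseteq> {..<n}" by (auto simp: D_support_def)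
    ultimately show ?thesis using card_le_fibres[of "{..<n}" snd "D_support n R" k] by simp
  qed
  show C: "card (C_support n R) \<le> n * k"
  proof -
    have "card {e \<in> C_support n R. fst e = p} \<le> k" for p
    proof -
      have "{e \<in> C_support n R. fst e = p} = Pair p ` {i. (p, i) \<in> C_support n R}" by auto
      then show ?thesis using C_row[of p] by (simp add: card_image inj_on_def)
    qed
    moreover have "fst ` C_support n R \<subseteq> {..<n}" by (auto simp: C_support_def)
    ultimately show ?thesis using card_le_fibres[of "{..<n}" fst "C_support n R" k] by simp
  qed
  show P: "card (row_pairs n R) \<le> n * k * k"
  proof -
    have "card {e \<in> row_pairs n R. (fst e, fst (snd e)) = (p, i')} \<le> k" for p i'
    proof -
      have "card {e \<in> row_pairs n R. (fst e, fst (snd e)) = (p, i')} \<le>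
          card ((\<lambda>i. (p, i', i)) ` {i. (p, i) \<in> C_support n R})"
        by (rule card_mono, rule finite_imageI, rule finite_subset[of _ "{..<m}"])
          (auto simp: row_pairs_def C_support_def)
      also have "\<dots> \<le> k" using C_row[of p] by (simp add: card_image inj_on_def)
      finally show ?thesis .
    qed
    then have "card (row_pairs n R) \<le> card (C_support n R) * k"
      by (intro card_le_fibres[where f = "\<lambda>e. (fst e, fst (snd e))"])
        (auto simp: finite_supports row_pairs_def)
    also have "\<dots> \<le> n * k * k" using C by simp
    finally show ?thesis .
  qed
  have "card (strict_row_pairs n R) \<le> card (row_pairs n R)"
    by (rule card_mono[OF finite_supports(6)]) (auto simp: strict_row_pairs_def)
  then show "card (strict_row_pairs n R) \<le> n * k * k" using P by simp
  show "card (overlap n R) \<le> n * k * k"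
  proof -
    \<comment> \<open>As every row of \<open>D\<close> has an entry, the inner dimension is at most
      the number of entries of \<open>D\<close>.\<close>
    have "{..<m} \<subseteq> fst ` D_support n R" using D_row_nonempty by force
    then have "m \<le> n * k"
      using D surj_card_le[OF finite_supports(2), of "{..<m}" fst] by simp
    have "card {e \<in> overlap n R. snd e = i} \<le> k" for i
    proof -
      have "{e \<in> overlap n R. snd e = i} = (\<lambda>i'. (i', i)) ` {i'. (i', i) \<in> overlap n R}" by auto
      then show ?thesis using overlap_col[of i] by (simp add: card_image inj_on_def)
    qed
    then have "card (overlap n R) \<le> card {..<m} * k"
      by (intro card_le_fibres[where f = snd]) (auto simp: overlap_def C_support_def)
    also have "\<dots> \<le> n * k * k" using \<open>m \<le> n * k\<close> by simp
    finally show ?thesis .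
  qed
  show "card (overlap_column_pairs n R) \<le> n * k * k"
  proof -
    have "card {e \<in> overlap_column_pairs n R. snd e = (i, j)} \<le> k" for i j
    proof -
      have "finite {i'. (i', i) \<in> overlap n R}"
        by (rule finite_subset[of _ "{..<m}"]) (auto simp: overlap_def C_support_def)
      then have "card {e \<in> overlap_column_pairs n R. snd e = (i, j)} \<le>
          card ((\<lambda>i'. (i', i, j)) ` {i'. (i', i) \<in> overlap n R})"
        by (intro card_mono) (auto simp: overlap_column_pairs_def)
      also have "\<dots> \<le> k" using overlap_col[of i] by (simp add: card_image inj_on_def)
      finally show ?thesis .
    qed
    then have "card (overlap_column_pairs n R) \<le> card (D_support n R) * k"
      by (intro card_le_fibres[where f = snd])
        (auto simp: finite_supports overlap_column_pairs_def)
    also have "\<dots> \<le> n * k * k" using D by simp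
    finally show ?thesis .
  qed
qed

end

text \<open>The update preserves \<open>x = A y - b\<close>: changing coordinate \<open>j\<close> of
  \<open>y\<close> changes \<open>A y\<close> by the same multiple of
  \<open>C d_j = q_j\<close>.\<close>

lemma (in sparse_factors) iterates_eq:
  assumes A: "A \<in> carrier_mat n n" and entry: "\<And>p j. p < n \<Longrightarrow> j < n \<Longrightarrow> A $$ (p, j) = cmult (dcol j) p"
    and "set picks \<subseteq> {..<n}"
  shows "iterates A (vec n b) (vec n y) picks =
    (vec n (residual (fold improve picks y)), vec n (fold improve picks y))"
proof -
  have "fold (iteration_step A) picks (vec n (residual y), vec n y) =
      (vec n (residual (fold improve picks y)), vec n (fold improve picks y))"
    using assms(3)
  proof (induction picks arbitrary: y)
    case (Cons j picks)
    then have j: "j < n" by simp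
    have col: "col A j = vec n (cmult (dcol j))"
      using A j by (intro eq_vecI) (auto simp: entry)
    have \<alpha>: "vec n (residual y) \<bullet> col A j / (col A j \<bullet> col A j) = step_size y j"
      unfolding col step_size_def by (simp add: scalar_prod_def atLeast0LessThan)
    have "(\<Sum>j'<n. cmult (dcol j') p * improve j y j') =
        (\<Sum>j'<n. cmult (dcol j') p * y j' - (if j' = j then step_size y j * cmult (dcol j) p else 0))"
      for p
      by (intro sum.cong) (auto simp: improve_def algebra_simps)
    then have "residual (improve j y) p = residual y p - step_size y j * cmult (dcol j) p" for p
      using j by (simp add: residual_def cmult_dmult sum_subtractf)
    then have 1: "vec n (residual y) - step_size y j \<cdot>\<^sub>v col A j = vec n (residual (improve j y))"
      unfolding col by (intro eq_vecI) auto
    have 2: "vec n y - step_size y j \<cdot>\<^sub>v unit_vec (dim_col A) j = vec n (improve j y)"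
      using A j by (intro eq_vecI) (auto simp: improve_def unit_vec_def)
    have "iteration_step A j (vec n (residual y), vec n y) =
        (vec n (residual (improve j y)), vec n (improve j y))"
      unfolding iteration_step_def Let_def prod.case \<alpha> 1 2 ..
    then show ?case using Cons.IH[of "improve j y"] Cons.prems by simp
  qed simp
  moreover have "A *\<^sub>v vec n y - vec n b = vec n (residual y)"
    using A by (intro eq_vecI)
      (auto simp: residual_def cmult_dmult entry scalar_prod_def atLeast0LessThan)
  ultimately show ?thesis unfolding iterates_def by simp
qed

text \<open>Built from \<open>n\<close> and \<open>F\<close> only; the matrix acts solely through
  the result of running \<open>F\<close>. This permits one solver for the whole class of
  matrices.\<close>

definition sparse_solver :: "nat \<Rightarrow> fact_prog \<Rightarrow> solver" where
  "sparse_solver n F = bind_prog (map_prog relocate (\<lambda>R. R) F) (setup_prog n)"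

lemma sparse_solver_solves:
  assumes A: "A \<in> carrier_mat n n" and F: "computes_sparse_factorization n k F A"
    and bv: "bv \<in> carrier_vec n" and y0: "y0 \<in> carrier_vec n" and picks: "set picks \<subseteq> {..<n}"
    and pos: "1 \<le> n" "1 \<le> k"
  shows "solves_iteratively_within n (sparse_solver n F) A bv y0 picks
    (33 * (n * k * k) + 19 * k * length picks + factorization_cost n F A)"
proof -
  define s where "s = init_store (system_input n A bv y0)"
  obtain R s1' t1 where run: "exec F (init_store (mat_input n A)) = (R, s1', t1)"
    by (metis prod_cases3)
  have s: "s \<circ> relocate = init_store (mat_input n A)"
    by (auto simp: s_def init_store_def relocate_def mat_input_def fun_eq_iff split: loc.splits)
  obtain s1 where s1: "exec (map_prog relocate (\<lambda>R. R) F) s = (R, s1, t1)" "s1 \<circ> relocate = s1'"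
      "\<And>l. l \<notin> range relocate \<Longrightarrow> s1 l = s l"
    using exec_map_prog[OF inj_relocate, of F s R s1' t1] run s by metis
  define C where "C p i = (if (p, i) \<in> C_support n R then s1 (cloc R p i) else 0)" for p i
  define D where "D i j = (if (i, j) \<in> D_support n R then s1 (dloc R i j) else 0)" for i j
  define Cm where "Cm = stored_mat n (width R) (entry_C R) s1'"
  define Dm where "Dm = stored_mat (width R) n (entry_D R) s1'"
  have nz: "only_nonzeros n (width R) (entry_C R) s1'" "only_nonzeros (width R) n (entry_D R) s1'"
    and fact: "sparse_factorization k A Cm Dm"
    using F run by (auto simp: computes_sparse_factorization_def run_factorization_def Cm_def Dm_def)
  have dims: "dim_row Cm = n" "dim_col Cm = width R" "dim_row Dm = width R" "dim_col Dm = n"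
    by (auto simp: Cm_def Dm_def stored_mat_def)
  \<comment> \<open>Stored entries are nonzero, so the pattern of options is the exact support. This
    is what carries the sparsity bound over to \<open>reach\<close>.\<close>
  have Cm: "Cm $$ (p, i) = C p i" "C p i = 0 \<longleftrightarrow> (p, i) \<notin> C_support n R"
    if "p < n" "i < width R" for p i
    using that nz(1) s1(2)
    by (auto simp: Cm_def stored_mat_def C_def C_support_def cloc_def only_nonzeros_def
        split: option.splits)
  have Dm: "Dm $$ (i, j) = D i j" "D i j = 0 \<longleftrightarrow> (i, j) \<notin> D_support n R"
    if "i < width R" "j < n" for i j
    using that nz(2) s1(2)
    by (auto simp: Dm_def stored_mat_def D_def D_support_def dloc_def only_nonzeros_def
        split: option.splits)
  have supp_C: "supp (col Cm i) = {p. (p, i) \<in> C_support n R}" if "i < width R" for i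
    using that Cm by (auto simp: supp_def dims C_support_def)
  have supp_D_row: "supp (row Dm i) = {j. (i, j) \<in> D_support n R}" if "i < width R" for i
    using that Dm by (auto simp: supp_def dims D_support_def)
  have supp_D_col: "supp (col Dm j) = {i. (i, j) \<in> D_support n R}" if "j < n" for j
    using that Dm by (auto simp: supp_def dims D_support_def)
  have fo: "forward_overlap Cm i = {i'. (i', i) \<in> overlap n R}" if "i < width R" for i
  proof -
    have meets: "supp (col Cm i) \<inter> supp (col Cm i') \<noteq> {} \<longleftrightarrow>
        (\<exists>p. (p, i) \<in> C_support n R \<and> (p, i') \<in> C_support n R)" if "i' < width R" for i'
      using supp_C[OF that] supp_C[OF \<open>i < width R\<close>] by auto
    have "i' \<in> forward_overlap Cm i \<longleftrightarrow> (i', i) \<in> overlap n R" for i'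
    proof (cases "i' < width R")
      case True
      then show ?thesis
        unfolding forward_overlap_def overlap_def mem_Collect_eq prod.case dims meets[OF True]
        by simp
    qed (auto simp: forward_overlap_def overlap_def dims C_support_def)
    then show ?thesis by auto
  qed
  have reach: "(\<Union>i\<in>supp (col Dm j). forward_overlap Cm i) = reach n R j" if "j < n" for j
  proof -
    have "(\<Union>i\<in>supp (col Dm j). forward_overlap Cm i) =
        (\<Union>i\<in>{i. (i, j) \<in> D_support n R}. {i'. (i', i) \<in> overlap n R})"
      unfolding supp_D_col[OF that] by (intro SUP_cong refl fo) (auto simp: D_support_def)
    then show ?thesis by (auto simp: reach_def)
  qed
  have product: "A = Cm * Dm"
    and cols: "i < width R \<Longrightarrow> supp (col Cm i) \<noteq> {}"
    and rows: "i < width R \<Longrightarrow> supp (row Dm i) \<noteq> {}"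
    and sparse: "j < n \<Longrightarrow> card (\<Union>i\<in>supp (col Dm j). forward_overlap Cm i) \<le> k" for i j
    using fact unfolding sparse_factorization_def dims by blast+
  interpret sparse_factors n k R C D "\<lambda>p. bv $ p"
  proof
    show "\<exists>p. (p, i) \<in> C_support n R" if "i < width R" for i
      using cols[OF that] supp_C[OF that] by auto
    show "\<exists>j. (i, j) \<in> D_support n R" if "i < width R" for i
      using rows[OF that] supp_D_row[OF that] by auto
    show "card (reach n R j) \<le> k" if "j < n" for j
      using sparse[OF that] reach[OF that] by simp
  qed (use pos in \<open>auto simp: C_def D_def\<close>)
  have entry: "A $$ (p, j) = cmult (dcol j) p" if "p < n" "j < n" for p j
    unfolding product using that
    by (simp add: scalar_prod_def dims cmult_def atLeast0LessThan Cm Dm)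
  \<comment> \<open>Running \<open>F\<close> leaves the work registers, \<open>b\<close> and the
    initial \<open>y\<close> at their initial contents.\<close>
  have not_range: "wloc w \<notin> range relocate" "In (InB p) \<notin> range relocate" "In (InY p) \<notin> range relocate"
    for w p by auto
  have zero: "s1 (wloc w) = 0" for w
    by (simp only: s1(3) not_range not_False_eq_True) (simp add: s_def init_store_def wloc_def)
  have "s1 (In (InB p)) = bv $ p" if "p < n" for p
    using that by (simp add: s1(3) not_range s_def init_store_def)
  then have "sound s1"
    unfolding sound_def by (simp add: zero C_def D_def)
  moreover have "s1 (In (InY j)) = y0 $ j" if "j < n" for j
    using that by (simp add: s1(3) not_range s_def init_store_def)
  ultimately obtain s2 t2 where 2: "exec (setup_prog n R) s1 =
      (\<lparr>step_code = step_prog n R, final_code = final_prog n R\<rparr>, s2, t2)"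
      "ready s2 (\<lambda>j. y0 $ j)"
      "t2 = 3 + 9 * card (D_support n R) + 3 * card (C_support n R) + 3 * card (row_pairs n R) +
       3 * card (strict_row_pairs n R) + 3 * card (overlap n R) +
       3 * card (overlap_column_pairs n R)"
    using exec_setup[of s1 "\<lambda>j. y0 $ j"] zero by blast
  obtain s3 t3 where 3: "exec_steps (step_prog n R) picks s2 = (s3, t3)" "t3 \<le> 19 * k * length picks"
      "ready s3 (fold improve picks (\<lambda>j. y0 $ j))"
    using exec_all_steps[OF 2(2) picks] by blast
  let ?y = "fold improve picks (\<lambda>j. y0 $ j)"
  obtain s4 where 4: "exec (final_prog n R) s3 =
      ((\<lambda>p. wloc (Resid p), \<lambda>j. In (InY j)), s4, 3 * card (C_support n R) + 3 * n)"
      "\<forall>p<n. s4 (wloc (Resid p)) = residual ?y p" "\<forall>j<n. s4 (In (InY j)) = ?y j"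
    using exec_final[OF 3(3)] by blast
  \<comment> \<open>33 = (3 + 9 + 3 + 4 * 3) + (3 + 3), from setup and output; every count,
    including 1 and \<open>n\<close>, is at most \<open>n k^2\<close>.\<close>
  have "t2 + (3 * card (C_support n R) + 3 * n) \<le> 33 * (n * k * k)"
  proof -
    have "n * k \<le> n * k * k" "1 \<le> n * k * k" using pos by auto
    moreover have "n \<le> n * k * k" using pos by (metis le_trans mult_le_mono2 mult.right_neutral)
    ultimately show ?thesis using cost_bounds unfolding 2(3) by linarith
  qed
  moreover have "vec n (\<lambda>p. bv $ p) = bv" "vec n (\<lambda>j. y0 $ j) = y0" using bv y0 by auto
  then have "iterates A bv y0 picks = (vec n (residual ?y), vec n ?y)"
    using iterates_eq[OF A entry picks, of "\<lambda>j. y0 $ j"] by simp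
  moreover have "run_solver n (sparse_solver n F) A bv y0 picks =
      ((vec n (residual ?y), vec n ?y), t1 + t2 + t3 + (3 * card (C_support n R) + 3 * n))"
    using 4(2,3) unfolding run_solver_def sparse_solver_def
    by (auto simp: exec_bind_prog s1(1) 2(1) 3(1) 4(1) simp flip: s_def intro!: eq_vecI)
  moreover have "factorization_cost n F A = t1"
    by (simp add: factorization_cost_def run_factorization_def run)
  ultimately show ?thesis using 3(2) unfolding solves_iteratively_within_def by auto
qed

text \<open>A nonzero matrix has inner dimension at least 1. Then column 0 of \<open>C\<close> meets
  itself, and some \<open>d_j\<close> has index 0 in its support, so the set counted for that
  \<open>j\<close> has an element. Positivity of \<open>k\<close> is what absorbs additive constants
  into the cost bounds.\<close>

lemma sparse_factorization_bound_pos: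
  assumes A: "A \<in> carrier_mat n n" "invertible_mat A" and "1 \<le> n" and fact: "sparse_factorization k A C D"
  shows "1 \<le> k"
proof (rule ccontr)
  assume "\<not> 1 \<le> k"
  have dims: "dim_row C = n" "dim_col D = n" "dim_col C = dim_row D" "A = C * D"
    using fact A unfolding sparse_factorization_def by auto
  have cols: "i < dim_col C \<Longrightarrow> supp (col C i) \<noteq> {}"
    and rows: "i < dim_row D \<Longrightarrow> supp (row D i) \<noteq> {}"
    and sparse: "j < dim_col D \<Longrightarrow> card (\<Union>i\<in>supp (col D j). forward_overlap C i) \<le> k" for i j
    using fact unfolding sparse_factorization_def by blast+
  have "dim_row D \<noteq> 0"
  proof
    assume 0: "dim_row D = 0"
    obtain B where B: "A * B = 1\<^sub>m n" and BA: "B * A = 1\<^sub>m (dim_row B)"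
      using A unfolding invertible_mat_def inverts_mat_def by auto
    have dim_B: "dim_col B = n" using arg_cong[OF B, of dim_col] by simp
    have zero: "A $$ (0, j) = 0" if "j < n" for j
      unfolding dims(4) using \<open>1 \<le> n\<close> that dims(1-3) 0 by (simp add: scalar_prod_def)
    have "(A * B) $$ (0, 0) = (\<Sum>j<dim_row B. row A 0 $ j * B $$ (j, 0))"
      using A(1) \<open>1 \<le> n\<close> dim_B by (simp add: scalar_prod_def atLeast0LessThan)
    also have "\<dots> = 0"
    proof (intro sum.neutral ballI)
      fix j assume "j \<in> {..<dim_row B}"
      have "dim_row B = n" using arg_cong[OF BA, of dim_col] A(1) by simp
      then show "row A 0 $ j * B $$ (j, 0) = 0" using zero A(1) \<open>1 \<le> n\<close> \<open>j \<in> _\<close> by simp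
    qed
    finally show False using B \<open>1 \<le> n\<close> by simp
  qed
  then have i: "0 < dim_row D" by simp
  then have "supp (row D 0) \<noteq> {}" by (rule rows)
  then obtain j where "j \<in> supp (row D 0)" by blast
  then have j: "j < n" "D $$ (0, j) \<noteq> 0" using i dims(2) by (auto simp: supp_def)
  have "0 \<in> forward_overlap C 0"
    using cols[of 0] i dims(3) by (auto simp: forward_overlap_def)
  moreover have "0 \<in> supp (col D j)" using i j dims by (simp add: supp_def)
  ultimately have "0 \<in> (\<Union>i\<in>supp (col D j). forward_overlap C i)" by blast
  moreover have "finite (\<Union>i\<in>supp (col D j). forward_overlap C i)"
    by (auto simp: supp_def forward_overlap_def)
  ultimately have "0 < card (\<Union>i\<in>supp (col D j). forward_overlap C i)"
    unfolding card_gt_0_iff by blast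
  moreover have "card (\<Union>i\<in>supp (col D j). forward_overlap C i) \<le> k"
    using sparse[of j] j(1) dims(2) by simp
  ultimately show False using \<open>\<not> 1 \<le> k\<close> by linarith
qed

section \<open>Programs branching on the zero pattern of expressions\<close>

instance arith_op :: countable
  by countable_datatype

text \<open>Once the pivot positions are fixed, each number arising in elimination is such an
  expression in the entries, independent of their values.\<close>

datatype expr = Entry nat nat | Op arith_op expr expr

instance expr :: countable
  by countable_datatype

primrec val :: "(nat \<times> nat \<Rightarrow> real) \<Rightarrow> expr \<Rightarrow> real" where
  "val v (Entry i j) = v (i, j)"
| "val v (Op f e e') = apply_op f (val v e) (val v e')"

text \<open>Each compound expression has its own register, so evaluating one expression never spoils the
  value of another.\<close>

definition eloc :: "expr \<Rightarrow> (nat \<times> nat) loc" where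
  "eloc e = (case e of Entry i j \<Rightarrow> In (i, j) | Op _ _ _ \<Rightarrow> Reg (to_nat e))"

lemma eloc_eq_iff [simp]: "eloc e = eloc e' \<longleftrightarrow> e = e'"
  by (auto simp: eloc_def split: expr.splits)

text \<open>Shared subexpressions are recomputed, each time writing the same value to the same
  register. Economy is irrelevant, since only the existence of a factorization program is at stake
  here.\<close>

primrec compile :: "expr \<Rightarrow> ((nat \<times> nat) loc, 'a) prog \<Rightarrow> ((nat \<times> nat) loc, 'a) prog" where
  "compile (Entry i j) p = p"
| "compile (Op f e e') p =
     compile e (compile e' (Arith (eloc (Op f e e')) f (eloc e) (eloc e') p))"

definition evaluated :: "(nat \<times> nat \<Rightarrow> real) \<Rightarrow> expr set \<Rightarrow> ((nat \<times> nat) loc \<Rightarrow> real) \<Rightarrow> bool" where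
  "evaluated v E s \<longleftrightarrow> (\<forall>a. s (In a) = v a) \<and> (\<forall>e\<in>E. s (eloc e) = val v e)"

lemma exec_compile:
  assumes "evaluated v E s"
  shows "\<exists>s' t. exec (compile e p) s = (case exec p s' of (a, s'', t') \<Rightarrow> (a, s'', t + t')) \<and>
    evaluated v (insert e E) s'"
  using assms
proof (induction e arbitrary: p s E)
  case (Entry i j)
  then have "evaluated v (insert (Entry i j) E) s" by (auto simp: evaluated_def eloc_def)
  then show ?case by (intro exI[of _ s] exI[of _ 0]) auto
next
  case (Op f e e')
  let ?p = "Arith (eloc (Op f e e')) f (eloc e) (eloc e') p"
  obtain s1 t1 where 1: "exec (compile e (compile e' ?p)) s =
      (case exec (compile e' ?p) s1 of (a, s'', t') \<Rightarrow> (a, s'', t1 + t'))"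
      "evaluated v (insert e E) s1"
    using Op.IH(1)[OF Op.prems] by blast
  obtain s2 t2 where 2: "exec (compile e' ?p) s1 =
      (case exec ?p s2 of (a, s'', t') \<Rightarrow> (a, s'', t2 + t'))"
      "evaluated v (insert e' (insert e E)) s2"
    using Op.IH(2)[OF 1(2)] by blast
  define s3 where "s3 = s2(eloc (Op f e e') := apply_op f (s2 (eloc e)) (s2 (eloc e')))"
  have "evaluated v (insert (Op f e e') E) s3"
    using 2(2) by (auto simp: evaluated_def s3_def) (simp_all add: eloc_def)
  moreover have "exec (compile (Op f e e') p) s =
      (case exec p s3 of (a, s'', t') \<Rightarrow> (a, s'', (t1 + t2 + 1) + t'))"
    by (simp add: 1(1) 2(1) s3_def split: prod.splits)
  ultimately show ?case by blast
qed

lemma exec_compile_all: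
  assumes "evaluated v E s"
  shows "\<exists>s' t. exec (foldr compile es p) s = (case exec p s' of (a, s'', t') \<Rightarrow> (a, s'', t + t')) \<and>
    evaluated v (set es \<union> E) s'"
  using assms
proof (induction es arbitrary: s E)
  case Nil
  then show ?case by (intro exI[of _ s] exI[of _ 0]) auto
next
  case (Cons e es)
  obtain s1 t1 where 1: "exec (compile e (foldr compile es p)) s =
      (case exec (foldr compile es p) s1 of (a, s'', t') \<Rightarrow> (a, s'', t1 + t'))"
      "evaluated v (insert e E) s1"
    using exec_compile[OF Cons.prems] by blast
  obtain s2 t2 where 2: "exec (foldr compile es p) s1 =
      (case exec p s2 of (a, s'', t') \<Rightarrow> (a, s'', t2 + t'))"
      "evaluated v (set es \<union> insert e E) s2"
    using Cons.IH[OF 1(2)] by blast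
  have "exec (foldr compile (e # es) p) s =
      (case exec p s2 of (a, s'', t') \<Rightarrow> (a, s'', (t1 + t2) + t'))"
    by (simp add: 1(1) 2(1) split: prod.splits)
  moreover have "evaluated v (set (e # es) \<union> E) s2" using 2(2) by simp
  ultimately show ?case by blast
qed

text \<open>Two comparisons decide equality with zero, as \<open>IfLe\<close> is the only test. The
  set of locations found to be zero is passed through the argument of \<open>g\<close> and so may
  determine the leaf.\<close>

primrec test_zeros :: "'l \<Rightarrow> 'l list \<Rightarrow> ('l set \<Rightarrow> 'a) \<Rightarrow> ('l, 'a) prog" where
  "test_zeros z [] g = Return (g {})"
| "test_zeros z (l # ls) g =
     IfLe l z (IfLe z l (test_zeros z ls (\<lambda>Z. g (insert l Z))) (test_zeros z ls g))
       (test_zeros z ls g)"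

lemma exec_test_zeros:
  assumes "s z = 0"
  shows "\<exists>t. exec (test_zeros z ls g) s = (g {l \<in> set ls. s l = 0}, s, t)"
proof (induction ls arbitrary: g)
  case (Cons l ls)
  obtain t where t: "exec (test_zeros z ls g) s = (g {l \<in> set ls. s l = 0}, s, t)"
    using Cons by blast
  obtain t' where t': "exec (test_zeros z ls (\<lambda>Z. g (insert l Z))) s =
      (g (insert l {l \<in> set ls. s l = 0}), s, t')"
    using Cons[of "\<lambda>Z. g (insert l Z)"] by blast
  have "{x \<in> set (l # ls). s x = 0} =
      (if s l = 0 then insert l {l \<in> set ls. s l = 0} else {l \<in> set ls. s l = 0})"
    by auto
  then show ?case using t t' assms by (cases "s l = 0") auto
qed simp

text \<open>An input position \<open>z\<close> supplies the zero to compare with, because registers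
  may be overwritten by values of expressions.\<close>

lemma ex_zero_pattern_prog:
  assumes "finite E"
  shows "\<exists>F. \<forall>v. v z = 0 \<longrightarrow> (\<exists>s t. exec F (init_store v) = (g {e \<in> E. val v e = 0}, s, t) \<and>
    (\<forall>e\<in>E. s (eloc e) = val v e))"
proof -
  obtain es where es: "set es = E" using finite_list[OF assms] by blast
  \<comment> \<open>The tests report locations; since \<open>eloc\<close> is injective, these
    translate back into expressions.\<close>
  define g' where "g' Z = g {e \<in> E. eloc e \<in> Z}" for Z
  define F where "F = foldr compile es (test_zeros (In z) (map eloc es) g')"
  have "\<exists>s t. exec F (init_store v) = (g {e \<in> E. val v e = 0}, s, t) \<and>
      (\<forall>e\<in>E. s (eloc e) = val v e)" if "v z = 0" for v
  proof -
    have "evaluated v {} (init_store v)" by (simp add: evaluated_def init_store_def)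
    from exec_compile_all[OF this, of es "test_zeros (In z) (map eloc es) g'"]
    obtain s t where s: "exec F (init_store v) =
        (case exec (test_zeros (In z) (map eloc es) g') s of (a, s'', t') \<Rightarrow> (a, s'', t + t'))"
        "evaluated v E s"
      unfolding F_def using es by auto
    then have "s (In z) = 0" using that unfolding evaluated_def by metis
    then obtain t' where t': "exec (test_zeros (In z) (map eloc es) g') s =
        (g' {l \<in> set (map eloc es). s l = 0}, s, t')"
      using exec_test_zeros[of s "In z" "map eloc es" g', OF \<open>s (In z) = 0\<close>] by (elim exE)
    have "{e \<in> E. eloc e \<in> {l \<in> set (map eloc es). s l = 0}} = {e \<in> E. val v e = 0}"
      using s(2) es by (auto simp: evaluated_def)
    then have "g' {l \<in> set (map eloc es). s l = 0} = g {e \<in> E. val v e = 0}"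
      unfolding g'_def by simp
    then show ?thesis using s t' by (auto simp: evaluated_def)
  qed
  then show ?thesis by blast
qed

section \<open>Pivoting and rank\<close>

text \<open>A rank-one Schur complement step. With a nonzero pivot it annihilates the row and the
  column of the pivot.\<close>

definition pivot_step :: "('i \<Rightarrow> 'j \<Rightarrow> real) \<Rightarrow> 'i \<times> 'j \<Rightarrow> 'i \<Rightarrow> 'j \<Rightarrow> real" where
  "pivot_step M e i j = M i j - M i (snd e) * M (fst e) j / M (fst e) (snd e)"

definition eliminate :: "('i \<Rightarrow> 'j \<Rightarrow> real) \<Rightarrow> ('i \<times> 'j) list \<Rightarrow> 'i \<Rightarrow> 'j \<Rightarrow> real" where
  "eliminate = foldl pivot_step"

primrec pivots :: "'i set \<Rightarrow> 'j set \<Rightarrow> ('i \<Rightarrow> 'j \<Rightarrow> real) \<Rightarrow> ('i \<times> 'j) list \<Rightarrow> bool" where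
  "pivots I J M [] \<longleftrightarrow> True"
| "pivots I J M (e # es) \<longleftrightarrow>
     fst e \<in> I \<and> snd e \<in> J \<and> M (fst e) (snd e) \<noteq> 0 \<and> pivots I J (pivot_step M e) es"

lemma eliminate_simps [simp]:
  "eliminate M [] = M" "eliminate M (e # es) = eliminate (pivot_step M e) es"
  by (simp_all add: eliminate_def)

lemma pivots_append:
  "pivots I J M (es @ es') \<longleftrightarrow> pivots I J M es \<and> pivots I J (eliminate M es) es'"
  by (induction es arbitrary: M) auto

lemma pivots_nth:
  assumes "pivots I J M es" and "t < length es"
  shows "fst (es ! t) \<in> I \<and> snd (es ! t) \<in> J \<and>
    eliminate M (take t es) (fst (es ! t)) (snd (es ! t)) \<noteq> 0"
proof -
  have "es = take t es @ (es ! t) # drop (Suc t) es" using assms(2) by (simp add: id_take_nth_drop)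
  then show ?thesis using assms(1) pivots_append[of I J M "take t es"] by (metis pivots.simps(2))
qed

text \<open>Telescoping: each step subtracts exactly one summand. At a zero pivot both the
  subtracted term and the summand are zero.\<close>

lemma eliminate_decomposition:
  "M i j = (\<Sum>t<length es. eliminate M (take t es) i (snd (es ! t)) *
      (eliminate M (take t es) (fst (es ! t)) j /
       eliminate M (take t es) (fst (es ! t)) (snd (es ! t)))) + eliminate M es i j"
proof (induction es arbitrary: M)
  case (Cons e es)
  have "M i j = M i (snd e) * (M (fst e) j / M (fst e) (snd e)) + pivot_step M e i j"
    by (simp add: pivot_step_def)
  then show ?case
    unfolding Cons[of "pivot_step M e"]
    by (simp add: sum.lessThan_Suc_shift del: sum.lessThan_Suc)
qed simp

text \<open>The pivot columns of the original matrix, restricted to the rows \<open>I\<close>, are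
  independent. A relation among them survives the first pivot step on the remaining columns, so by
  induction their coefficients vanish, and the pivot row then kills the first coefficient.\<close>

lemma pivot_columns_independent:
  assumes "pivots I J M es"
  shows "distinct (map snd es) \<and>
    (\<forall>a. (\<forall>i\<in>I. (\<Sum>q\<in>snd ` set es. a q * M i q) = 0) \<longrightarrow> (\<forall>q\<in>snd ` set es. a q = 0))"
  using assms
proof (induction es arbitrary: M)
  case (Cons e es)
  obtain p q where e: "e = (p, q)" by fastforce
  let ?M = "pivot_step M e" and ?Q = "snd ` set es"
  have pq: "p \<in> I" "M p q \<noteq> 0" "pivots I J ?M es" using Cons.prems e by auto
  note IH = Cons.IH[OF pq(3)]
  \<comment> \<open>Column \<open>q\<close> vanishes after the step, and a vanishing column cannot
    belong to an independent family.\<close>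
  have q_fresh: "q \<notin> ?Q"
  proof
    assume "q \<in> ?Q"
    have "(\<Sum>q'\<in>?Q. (if q' = q then 1 else 0) * ?M i q') = 0" for i
      using pq(2) by (intro sum.neutral) (auto simp: pivot_step_def e)
    then show False using IH[THEN conjunct2, rule_format, of "\<lambda>q'. if q' = q then 1 else 0" q]
        \<open>q \<in> ?Q\<close> by simp
  qed
  then have "distinct (map snd (e # es))" using IH e by simp
  moreover have "\<forall>q'\<in>insert q ?Q. a q' = 0"
    if a: "\<forall>i\<in>I. (\<Sum>q'\<in>insert q ?Q. a q' * M i q') = 0" for a
  proof -
    have split: "(\<Sum>q'\<in>?Q. a q' * M i q') = - (a q * M i q)" if "i \<in> I" for i
      using a[rule_format, OF that] q_fresh by simp
    \<comment> \<open>Subtracting the multiple \<open>M i q / M p q\<close> of the relation in row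
      \<open>p\<close> from the one in row \<open>i\<close> cancels the contribution of column
      \<open>q\<close>.\<close>
    have "(\<Sum>q'\<in>?Q. a q' * ?M i q') = 0" if "i \<in> I" for i
    proof -
      have "(\<Sum>q'\<in>?Q. a q' * ?M i q') =
          (\<Sum>q'\<in>?Q. a q' * M i q' - M i q / M p q * (a q' * M p q'))"
        by (intro sum.cong) (auto simp: pivot_step_def e algebra_simps)
      also have "\<dots> = (\<Sum>q'\<in>?Q. a q' * M i q') - M i q / M p q * (\<Sum>q'\<in>?Q. a q' * M p q')"
        by (simp add: sum_subtractf sum_distrib_left)
      also have "\<dots> = 0" unfolding split[OF that] split[OF pq(1)] using pq(2) by simp
      finally show ?thesis .
    qed
    then have "\<forall>q'\<in>?Q. a q' = 0" using IH by blast
    moreover from this have "(\<Sum>q'\<in>?Q. a q' * M p q') = 0" by (intro sum.neutral) simp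
    then have "a q = 0" using split[OF pq(1)] pq(2) by simp
    ultimately show ?thesis by simp
  qed
  moreover have "snd ` set (e # es) = insert q ?Q" using e by simp
  ultimately show ?case by presburger
qed simp

lemma length_pivots_le_rank:
  assumes A: "A \<in> carrier_mat n n" and I: "I \<subseteq> {..<n}" and J: "J \<subseteq> {..<n}"
    and piv: "pivots I J (\<lambda>i j. A $$ (i, j)) es"
  shows "length es \<le> mat_rank (submatrix A I J)"
proof -
  define B where "B = submatrix A I J"
  \<comment> \<open>\<open>submatrix\<close> renumbers: an index \<open>q\<close> of
    \<open>J\<close> becomes the number of smaller elements of \<open>J\<close>. Thus
    \<open>c q\<close> is the column of the submatrix that comes from column
    \<open>q\<close>.\<close>
  define c where "c q = col B (card {a \<in> J. a < q})" for q
  let ?Q = "snd ` set es"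
  note ind = pivot_columns_independent[OF piv]
  have Q: "?Q \<subseteq> J" using pivots_nth[OF piv] by (metis image_subsetI in_set_conv_nth)
  have finJ: "finite J" and finI: "finite I" using I J finite_subset by auto
  have Jn: "{j. j < n \<and> j \<in> J} = J" and In: "{i. i < n \<and> i \<in> I} = I" using I J by auto
  have dims: "dim_row B = card I" "dim_col B = card J"
    using A by (simp_all add: B_def dim_submatrix Jn In)
  have idx: "card {a \<in> J. a < q} < card J" if "q \<in> J" for q
    using that finJ by (intro psubset_card_mono) auto
  have idxI: "card {a \<in> I. a < q} < card I" if "q \<in> I" for q
    using that finI by (intro psubset_card_mono) auto
  have c: "c q $ (card {a \<in> I. a < i}) = A $$ (i, q)" if "q \<in> J" "i \<in> I" for q i
  proof -
    have "B $$ (card {a \<in> I. a < i}, card {a \<in> J. a < q}) = A $$ (i, q)"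
      unfolding B_def using that A I J by (intro submatrix_index_card) auto
    then show ?thesis using idx[OF that(1)] idxI[OF that(2)] by (simp add: c_def dims)
  qed
  interpret vec_space "TYPE(real)" "dim_row B" .
  have inj: "inj_on c ?Q"
  proof (rule inj_onI, rule ccontr)
    fix q q' assume q: "q \<in> ?Q" "q' \<in> ?Q" "c q = c q'" "q \<noteq> q'"
    define a where "a x = (if x = q then 1 else if x = q' then - 1 else 0 :: real)" for x
    have "(\<Sum>x\<in>?Q. a x * A $$ (i, x)) = 0" if "i \<in> I" for i
    proof -
      have "(\<Sum>x\<in>?Q. a x * A $$ (i, x)) = (\<Sum>x\<in>{q, q'}. a x * A $$ (i, x))"
        using q by (intro sum.mono_neutral_right) (auto simp: a_def)
      also have "\<dots> = A $$ (i, q) - A $$ (i, q')" using q(4) by (simp add: a_def)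
      also have "\<dots> = 0"
      proof -
        have "q \<in> J" "q' \<in> J" using q(1,2) Q by blast+
        then show ?thesis using c[of q i] c[of q' i] q(3) that by simp
      qed
      finally show ?thesis .
    qed
    then have "a q = 0" using ind q(1) by blast
    then show False by (simp add: a_def)
  qed
  have sub: "c ` ?Q \<subseteq> set (cols B)"
    using Q idx dims by (auto simp: c_def cols_def)
  then have car: "c ` ?Q \<subseteq> carrier_vec (dim_row B)" using cols_dim by blast
  have "lin_indpt (c ` ?Q)"
  proof (rule finite_lin_indpt2)
    show "finite (c ` ?Q)" by simp
    show "c ` ?Q \<subseteq> carrier_vec (dim_row B)" by (rule car)
    fix a assume a: "lincomb a (c ` ?Q) = 0\<^sub>v (dim_row B)"
    have "(\<Sum>q\<in>?Q. a (c q) * A $$ (i, q)) = 0" if "i \<in> I" for i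
    proof -
      let ?i = "card {a \<in> I. a < i}"
      have "?i < dim_row B" using idxI[OF that] dims by simp
      then have "0 = lincomb a (c ` ?Q) $ ?i" using a by simp
      also have "\<dots> = (\<Sum>x\<in>c ` ?Q. a x * x $ ?i)"
        using lincomb_index[OF \<open>?i < dim_row B\<close> car] by simp
      also have "\<dots> = (\<Sum>q\<in>?Q. a (c q) * c q $ ?i)" by (simp add: sum.reindex[OF inj])
      also have "\<dots> = (\<Sum>q\<in>?Q. a (c q) * A $$ (i, q))"
        using c that Q by (intro sum.cong) auto
      finally show ?thesis by simp
    qed
    then show "\<forall>v\<in>c ` ?Q. a v = 0" using ind[THEN conjunct2, rule_format, of "\<lambda>q. a (c q)"] by blast
  qed
  then have "card (c ` ?Q) \<le> rank B"
    using sub by (intro rank_ge_card_indpt) auto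
  moreover have "card (c ` ?Q) = length es"
    using ind card_image[OF inj] distinct_card[of "map snd es"] by simp
  ultimately show ?thesis by (simp add: mat_rank_def B_def)
qed

text \<open>A longest pivot sequence works, since a nonzero entry left over would be a further
  pivot.\<close>

lemma ex_complete_pivots:
  assumes "\<And>es. pivots I J M es \<Longrightarrow> length es \<le> r"
  shows "\<exists>es. pivots I J M es \<and> length es \<le> r \<and> (\<forall>i\<in>I. \<forall>j\<in>J. eliminate M es i j = 0)"
proof -
  have "\<forall>es. pivots I J M es \<longrightarrow> length es < Suc r" using assms by (simp add: less_Suc_eq_le)
  then obtain es where es: "pivots I J M es" "\<And>es'. pivots I J M es' \<Longrightarrow> length es' \<le> length es"
    using ex_has_greatest_nat[of "pivots I J M" "[]" length "Suc r"] by auto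
  have "eliminate M es i j = 0" if "i \<in> I" "j \<in> J" for i j
  proof (rule ccontr)
    assume "eliminate M es i j \<noteq> 0"
    then have "pivots I J M (es @ [(i, j)])" using es(1) that by (simp add: pivots_append)
    then show False using es(2) by fastforce
  qed
  then show ?thesis using es(1) assms by blast
qed

section \<open>Elimination on symbolic entries\<close>

definition pivot_step_expr :: "(nat \<Rightarrow> nat \<Rightarrow> expr) \<Rightarrow> nat \<times> nat \<Rightarrow> nat \<Rightarrow> nat \<Rightarrow> expr" where
  "pivot_step_expr M e i j =
     Op Minus (M i j) (Op Divide (Op Times (M i (snd e)) (M (fst e) j)) (M (fst e) (snd e)))"

definition eliminate_expr :: "(nat \<times> nat) list \<Rightarrow> nat \<Rightarrow> nat \<Rightarrow> expr" where
  "eliminate_expr = foldl pivot_step_expr Entry"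

lemma val_eliminate_expr:
  "val v (eliminate_expr es i j) = eliminate (\<lambda>i j. v (i, j)) es i j"
proof -
  have "val v (foldl pivot_step_expr M es i j) = eliminate (\<lambda>i j. val v (M i j)) es i j" for M
  proof (induction es arbitrary: M)
    case (Cons e es)
    have "(\<lambda>i j. val v (pivot_step_expr M e i j)) = pivot_step (\<lambda>i j. val v (M i j)) e"
      by (simp add: pivot_step_expr_def pivot_step_def fun_eq_iff)
    then show ?case using Cons by simp
  qed simp
  from this[of Entry] show ?thesis by (simp add: eliminate_expr_def)
qed

section \<open>Blocks of a dendrogram\<close>

type_synonym block = "nat \<times> nat set \<times> nat set"

text \<open>A block carries the height of the node whose diagonal block it subdivides, and height \<open>0\<close> if
  it is a diagonal block.\<close>

definition blocks :: "nat \<Rightarrow> nat \<Rightarrow> (nat \<Rightarrow> nat set set) \<Rightarrow> block set" where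
  "blocks n h P = (\<lambda>j. (0, {j}, {j})) ` {..<n} \<union>
     {(i, I, J). 1 \<le> i \<and> i \<le> h \<and> (\<exists>X\<in>P i. I \<in> children P i X \<and> J \<in> children P i X \<and> I \<noteq> J)}"

definition node :: "(nat \<Rightarrow> nat set set) \<Rightarrow> nat \<Rightarrow> nat \<Rightarrow> nat set" where
  "node P i p = (THE X. X \<in> P i \<and> p \<in> X)"

locale dendro =
  fixes n h :: nat and P :: "nat \<Rightarrow> nat set set"
  assumes dendrogram: "dendrogram n h P" and two_le_n: "2 \<le> n"
begin

section \<open>Nodes containing a given index\<close>

lemma top: "P h = {{..<n}}" and bottom: "P 0 = (\<lambda>j. {j}) ` {..<n}"
  using dendrogram by (auto simp: dendrogram_def)

text \<open>With at least two indices the one-block partition differs from the singletons. This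
  later gives \<open>h + 1 \<le> 2 * h\<close>.\<close>

lemma height_pos: "1 \<le> h"
proof (rule ccontr)
  assume "\<not> 1 \<le> h"
  then have "h = 0" by simp
  then have "{..<n} \<in> P 0" using top by simp
  then have "{..<n} \<in> (\<lambda>j. {j}) ` {..<n}" unfolding bottom .
  then obtain j where "{..<n} = {j}" by blast
  moreover have "0 \<in> {..<n}" "1 \<in> {..<n}" using two_le_n by auto
  ultimately show False by (metis singletonD zero_neq_one)
qed

lemma part: "i \<le> h \<Longrightarrow> partition_on {..<n} (P i)"
proof -
  assume "i \<le> h"
  show ?thesis
  proof (cases "i = h")
    case True
    have "i - 1 < h" "Suc (i - 1) = i" using height_pos True by auto
    then show ?thesis using dendrogram unfolding dendrogram_def refines_def by metis
  next
    case False
    then show ?thesis using \<open>i \<le> h\<close> dendrogram unfolding dendrogram_def refines_def by auto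
  qed
qed

lemma node_eq: "i \<le> h \<Longrightarrow> X \<in> P i \<Longrightarrow> p \<in> X \<Longrightarrow> node P i p = X"
  unfolding node_def
  by (rule the_equality) (use part[of i] in \<open>auto simp: partition_on_def disjoint_def\<close>)

lemma node: "i \<le> h \<Longrightarrow> p < n \<Longrightarrow> node P i p \<in> P i \<and> p \<in> node P i p"
proof -
  assume "i \<le> h" "p < n"
  then have "p \<in> \<Union>(P i)" using part[of i] by (auto simp: partition_on_def)
  then obtain X where "X \<in> P i" "p \<in> X" by blast
  then show ?thesis using node_eq \<open>i \<le> h\<close> by auto
qed

lemma node_subset: "i \<le> h \<Longrightarrow> X \<in> P i \<Longrightarrow> X \<subseteq> {..<n}"
  using part[of i] by (auto simp: partition_on_def)

lemma node_nonempty: "i \<le> h \<Longrightarrow> X \<in> P i \<Longrightarrow> X \<noteq> {}"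
  using part[of i] by (auto simp: partition_on_def)

lemma finite_partition: "i \<le> h \<Longrightarrow> finite (P i)"
  using part[of i] finite_elements by blast

lemma node_0: "p < n \<Longrightarrow> node P 0 p = {p}"
  using bottom by (intro node_eq) auto

lemma node_h: "p < n \<Longrightarrow> node P h p = {..<n}"
  using top by (intro node_eq) auto

lemma node_mono: "i \<le> j \<Longrightarrow> j \<le> h \<Longrightarrow> p < n \<Longrightarrow> node P i p \<subseteq> node P j p"
proof (induction j rule: dec_induct)
  case (step j)
  then have j: "j \<le> h" "j < h" by auto
  have "node P j p \<in> P j" "p \<in> node P j p" using node j step.prems by auto
  then obtain Y where Y: "Y \<in> P (Suc j)" "node P j p \<subseteq> Y"
    using dendrogram j unfolding dendrogram_def refines_def by metis
  then have "node P (Suc j) p = Y" using node_eq[of "Suc j" Y p] \<open>p \<in> _\<close> step.prems by auto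
  then show ?case using step Y by auto
qed simp

lemma node_cong: "i \<le> j \<Longrightarrow> j \<le> h \<Longrightarrow> p < n \<Longrightarrow> q < n \<Longrightarrow> node P i p = node P i q \<Longrightarrow> node P j p = node P j q"
  using node_mono[of i j p] node[of j p] node[of i q] node_eq[of j "node P j p" q] by fastforce

lemma childD:
  assumes "1 \<le> i" "i \<le> h" "X \<in> P i" "I \<in> children P i X"
  shows "I \<in> P (i - 1)" "I \<subseteq> X" "I \<subseteq> {..<n}" "I \<noteq> {}"
    "p \<in> I \<Longrightarrow> node P i p = X" "p \<in> I \<Longrightarrow> node P (i - 1) p = I"
proof -
  show I: "I \<in> P (i - 1)" "I \<subseteq> X" using assms by (auto simp: children_def)
  have le: "i - 1 \<le> h" using assms by simp
  show sub: "I \<subseteq> {..<n}" "I \<noteq> {}" using node_subset[OF le I(1)] node_nonempty[OF le I(1)] by auto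
  show "node P i p = X" if "p \<in> I" using node_eq assms I that by blast
  show "node P (i - 1) p = I" if "p \<in> I" using node_eq le I that by blast
qed

lemma node_child: "1 \<le> i \<Longrightarrow> i \<le> h \<Longrightarrow> p < n \<Longrightarrow> node P (i - 1) p \<in> children P i (node P i p)"
  using node[of "i - 1" p] node_mono[of "i - 1" i p] by (auto simp: children_def)

lemma card_children_le: "1 \<le> i \<Longrightarrow> i \<le> h \<Longrightarrow> X \<in> P i \<Longrightarrow> card (children P i X) \<le> max_degree h P"
proof -
  assume i: "1 \<le> i" "i \<le> h" "X \<in> P i"
  have "{card (children P i X) | i X. 1 \<le> i \<and> i \<le> h \<and> X \<in> P i} =
      (\<lambda>(i, X). card (children P i X)) ` (SIGMA i:{1..h}. P i)"
    by force
  moreover have "finite (SIGMA i:{1..h}. P i)" using finite_partition by auto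
  ultimately have "finite {card (children P i X) | i X. 1 \<le> i \<and> i \<le> h \<and> X \<in> P i}" by simp
  then show ?thesis unfolding max_degree_def using i by (intro Max_ge) auto
qed

lemma finite_children: "i \<le> h \<Longrightarrow> finite (children P i X)"
  using finite_partition[of "i - 1"] by (auto simp: children_def)

text \<open>The height is the least one at which \<open>p\<close> and \<open>q\<close> share a node;
  it is positive because nodes at height 0 are singletons.\<close>

lemma ex_split_height:
  assumes "p < n" "q < n" "p \<noteq> q"
  obtains i where "1 \<le> i" "i \<le> h" "node P i p = node P i q" "node P (i - 1) p \<noteq> node P (i - 1) q"
proof -
  define i where "i = (LEAST i. node P i p = node P i q)"
  have h: "node P h p = node P h q" using node_h assms by simp
  have 1: "node P i p = node P i q" unfolding i_def using h by (rule LeastI)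
  have 2: "i \<le> h" unfolding i_def using h by (rule Least_le)
  have "i \<noteq> 0"
  proof
    assume "i = 0"
    then have "{p} = {q}" using 1 node_0 assms by simp
    then show False using assms(3) by simp
  qed
  moreover have "node P (i - 1) p \<noteq> node P (i - 1) q"
    using not_less_Least[of "i - 1" "\<lambda>i. node P i p = node P i q"] \<open>i \<noteq> 0\<close> unfolding i_def by auto
  moreover have "1 \<le> i" using \<open>i \<noteq> 0\<close> by simp
  ultimately show ?thesis using 1 2 that by blast
qed

text \<open>The node in which 0 and 1 first meet has two different children.\<close>

lemma two_le_max_degree: "2 \<le> max_degree h P"
proof -
  have pq: "0 < n" "1 < n" "(0::nat) \<noteq> 1" using two_le_n by auto
  obtain i where i: "1 \<le> i" "i \<le> h" "node P i 0 = node P i 1" "node P (i - 1) 0 \<noteq> node P (i - 1) 1"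
    using ex_split_height[OF pq] by blast
  have "{node P (i - 1) 0, node P (i - 1) 1} \<subseteq> children P i (node P i 0)"
    using node_child[OF i(1,2) pq(1)] node_child[OF i(1,2) pq(2)] i(3) by simp
  then have "card {node P (i - 1) 0, node P (i - 1) 1} \<le> card (children P i (node P i 0))"
    using card_mono finite_children[OF i(2)] by blast
  then have "2 \<le> card (children P i (node P i 0))" using i(4) by (simp add: card_insert_if)
  also have "\<dots> \<le> max_degree h P" using card_children_le node i pq by blast
  finally show ?thesis .
qed

section \<open>Blocks as a partition of the index square\<close>

lemma finite_blocks: "finite (blocks n h P)"
proof (rule finite_subset)
  show "blocks n h P \<subseteq> {..h} \<times> Pow {..<n} \<times> Pow {..<n}"
    by (auto simp: blocks_def dest!: childD(3)[rotated 3])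
qed simp

lemma block_subset: "(i, I, J) \<in> blocks n h P \<Longrightarrow> I \<subseteq> {..<n} \<and> J \<subseteq> {..<n}"
  using childD(3) unfolding blocks_def by blast

text \<open>An off-diagonal position lies in the block formed at the height where its two indices
  first share a node, and in no other block.\<close>

lemma ex1_block:
  assumes "p < n" "q < n"
  shows "\<exists>!B. B \<in> blocks n h P \<and> p \<in> fst (snd B) \<and> q \<in> snd (snd B)"
proof (cases "p = q")
  case True
  show ?thesis
  proof (rule ex1I[of _ "(0, {p}, {p})"])
    show "(0, {p}, {p}) \<in> blocks n h P \<and> p \<in> fst (snd (0, {p}, {p})) \<and> q \<in> snd (snd (0, {p}, {p}))"
      using True assms by (auto simp: blocks_def)
    fix B assume B: "B \<in> blocks n h P \<and> p \<in> fst (snd B) \<and> q \<in> snd (snd B)"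
    obtain i I J where [simp]: "B = (i, I, J)" by (cases B)
    have "\<not> (1 \<le> i \<and> i \<le> h \<and> (\<exists>X\<in>P i. I \<in> children P i X \<and> J \<in> children P i X \<and> I \<noteq> J))"
      using childD(6)[of i _ I p] childD(6)[of i _ J p] B True by auto
    then show "B = (0, {p}, {p})" using B True by (auto simp: blocks_def)
  qed
next
  case False
  obtain i where i: "1 \<le> i" "i \<le> h" "node P i p = node P i q" "node P (i - 1) p \<noteq> node P (i - 1) q"
    using ex_split_height[OF assms False] by blast
  show ?thesis
  proof (rule ex1I[of _ "(i, node P (i - 1) p, node P (i - 1) q)"])
    have "node P (i - 1) p \<in> children P i (node P i p)" "node P (i - 1) q \<in> children P i (node P i p)"
      using node_child[OF i(1,2) assms(1)] node_child[OF i(1,2) assms(2)] i(3) by auto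
    then have "(i, node P (i - 1) p, node P (i - 1) q) \<in> blocks n h P"
      using i node[of i p] assms unfolding blocks_def by blast
    then show "(i, node P (i - 1) p, node P (i - 1) q) \<in> blocks n h P \<and>
        p \<in> fst (snd (i, node P (i - 1) p, node P (i - 1) q)) \<and>
        q \<in> snd (snd (i, node P (i - 1) p, node P (i - 1) q))"
      using node[of "i - 1"] i assms by auto
    fix B assume B: "B \<in> blocks n h P \<and> p \<in> fst (snd B) \<and> q \<in> snd (snd B)"
    obtain i' I J where [simp]: "B = (i', I, J)" by (cases B)
    obtain X where X: "1 \<le> i'" "i' \<le> h" "X \<in> P i'" "I \<in> children P i' X" "J \<in> children P i' X" "I \<noteq> J"
      using B False by (auto simp: blocks_def)
    have pq: "p \<in> I" "q \<in> J" using B by auto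
    have eqs: "node P i' p = X" "node P i' q = X" "node P (i' - 1) p = I" "node P (i' - 1) q = J"
      using childD(5,6)[OF X(1-3) X(4) pq(1)] childD(5,6)[OF X(1-3) X(5) pq(2)] by auto
    \<comment> \<open>If one height were smaller, \<open>p\<close> and \<open>q\<close> would
      already share a node just below the larger one, where they are separated.\<close>
    have "i - 1 \<le> h" "i' - 1 \<le> h" using i(2) X(2) by auto
    then have "\<not> i' \<le> i - 1" "\<not> i \<le> i' - 1"
      using node_cong[of i' "i - 1" p q] node_cong[of i "i' - 1" p q] eqs i(3,4) assms X(6) by auto
    then have "i' = i" using X(1) i(1) by linarith
    then show "B = (i, node P (i - 1) p, node P (i - 1) q)" using eqs by simp
  qed
qed

text \<open>The recursion of \<open>elementary_blocks\<close> is followed upwards from the height of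
  the block, along the nodes containing a fixed row index \<open>p\<close> of it.\<close>

lemma block_elementary:
  assumes "(i, I, J) \<in> blocks n h P"
  shows "(I, J) \<in> elementary_blocks P h {..<n}"
proof -
  have cases: "(i = 0 \<and> (\<exists>j<n. I = {j} \<and> J = {j})) \<or> (1 \<le> i \<and> i \<le> h \<and>
      (\<exists>X\<in>P i. I \<in> children P i X \<and> J \<in> children P i X \<and> I \<noteq> J))"
    using assms by (auto simp: blocks_def)
  obtain p where p: "p \<in> I" "p < n" using cases childD(3,4) by (metis insertI1 lessThan_iff subset_empty subset_iff ex_in_conv)
  have sub: "I \<subseteq> node P i p" using cases
  proof
    assume "i = 0 \<and> (\<exists>j<n. I = {j} \<and> J = {j})"
    then show ?thesis using p node[of 0 p] by auto
  next
    assume "1 \<le> i \<and> i \<le> h \<and> (\<exists>X\<in>P i. I \<in> children P i X \<and> J \<in> children P i X \<and> I \<noteq> J)"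
    then show ?thesis using p childD(2,5) by metis
  qed
  have "i \<le> h" using cases by auto
  have "(I, J) \<in> elementary_blocks P g (node P g p)" if "i \<le> g" "g \<le> h" for g
    using that
  proof (induction g)
    case 0
    then show ?case using cases p node_0 by auto
  next
    case (Suc g)
    show ?case
    proof (cases "i = Suc g")
      case True
      then obtain X where X: "X \<in> P i" "I \<in> children P i X" "J \<in> children P i X" "I \<noteq> J"
        using cases by auto
      then have "node P (Suc g) p = X" using childD(5)[of i X I p] p True Suc.prems by auto
      then show ?thesis using X True by simp
    next
      case False
      then have "(I, J) \<in> elementary_blocks P g (node P g p)" using Suc by auto
      moreover have "node P g p \<in> children P (Suc g) (node P (Suc g) p)"
        using node_child[of "Suc g" p] Suc.prems p by simp
      ultimately show ?thesis by auto
    qed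
  qed
  from this[of h] show ?thesis using \<open>i \<le> h\<close> node_h p by simp
qed

text \<open>Each height from 1 to \<open>h\<close> offers at most \<open>d (d - 1)\<close> ordered
  pairs of children with \<open>r\<close> terms each. As \<open>d\<close> is at least 2, the
  \<open>r\<close> diagonal terms cost no more than one further height, whence
  \<open>h + 1\<close>.\<close>

lemma card_reachable_terms:
  assumes "q < n"
  shows "card ({(0, {q}, {q})} \<times> {..<r} \<union>
      (\<Union>i\<in>{1..h}. (\<lambda>((I, J), t). ((i, I, J), t)) `
        ({(I, J). I \<in> children P i (node P i q) \<and> J \<in> children P i (node P i q) \<and> I \<noteq> J} \<times> {..<r})))
    \<le> r * max_degree h P * (max_degree h P - 1) * (h + 1)"
    (is "card (?S \<union> (\<Union>i\<in>_. ?T i)) \<le> r * ?d * _ * _")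
proof -
  have T: "card (?T i) \<le> ?d * (?d - 1) * r" if i: "i \<in> {1..h}" for i
  proof -
    let ?Ch = "children P i (node P i q)"
    have fin: "finite ?Ch" using finite_children i by simp
    have le: "card ?Ch \<le> ?d" using card_children_le[of i "node P i q"] node[of i q] i assms by simp
    have "{(I, J). I \<in> ?Ch \<and> J \<in> ?Ch \<and> I \<noteq> J} = (SIGMA I:?Ch. ?Ch - {I})" by auto
    then have "card {(I, J). I \<in> ?Ch \<and> J \<in> ?Ch \<and> I \<noteq> J} = card ?Ch * (card ?Ch - 1)"
      using fin by simp
    also have "\<dots> \<le> ?d * (?d - 1)" using le by (intro mult_le_mono) auto
    finally have "card ({(I, J). I \<in> ?Ch \<and> J \<in> ?Ch \<and> I \<noteq> J} \<times> {..<r}) \<le> ?d * (?d - 1) * r"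
      by (simp add: card_cartesian_product)
    moreover have "finite {(I, J). I \<in> ?Ch \<and> J \<in> ?Ch \<and> I \<noteq> J}"
      by (rule finite_subset[of _ "?Ch \<times> ?Ch"]) (use fin in auto)
    ultimately show ?thesis by (meson card_image_le finite_SigmaI finite_lessThan le_trans)
  qed
  have "card (\<Union>i\<in>{1..h}. ?T i) \<le> (\<Sum>i\<in>{1..h}. card (?T i))" by (rule card_UN_le) simp
  also have "\<dots> \<le> h * (?d * (?d - 1) * r)" using sum_bounded_above[of "{1..h}" _ "?d * (?d - 1) * r"] T by simp
  finally have U: "card (\<Union>i\<in>{1..h}. ?T i) \<le> h * (?d * (?d - 1) * r)" .
  have "1 * 1 \<le> ?d * (?d - 1)" using two_le_max_degree by (intro mult_le_mono) auto
  then have S: "card ?S \<le> ?d * (?d - 1) * r" by (simp add: card_cartesian_product)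
  have comm: "a * b * r + h * (a * b * r) = r * a * b * (h + 1)" for a b
    by (simp add: algebra_simps)
  have "card (?S \<union> (\<Union>i\<in>{1..h}. ?T i)) \<le> card ?S + card (\<Union>i\<in>{1..h}. ?T i)"
    by (rule card_Un_le)
  also have "\<dots> \<le> ?d * (?d - 1) * r + h * (?d * (?d - 1) * r)" by (rule add_mono[OF S U])
  finally show ?thesis unfolding comm .
qed

end

section \<open>Factorization of hierarchical matrices\<close>

abbreviation block_rows :: "block \<Rightarrow> nat set" where
  "block_rows B \<equiv> fst (snd B)"

abbreviation block_cols :: "block \<Rightarrow> nat set" where
  "block_cols B \<equiv> snd (snd B)"

text \<open>One rank-one term of the factorization for each pivot of each block. Sorting by height makes
  the forward overlaps of a term belong to blocks above it in the dendrogram.\<close>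

definition term_list :: "block set \<Rightarrow> (block \<Rightarrow> (nat \<times> nat) list) \<Rightarrow> (block \<times> nat) list" where
  "term_list bs \<sigma> = (SOME ts. distinct ts \<and> set ts = (SIGMA B:bs. {..<length (\<sigma> B)}) \<and>
     sorted (map (fst \<circ> fst) ts))"

lemma term_list:
  assumes "finite bs"
  shows "distinct (term_list bs \<sigma>)" "set (term_list bs \<sigma>) = (SIGMA B:bs. {..<length (\<sigma> B)})"
    "sorted (map (fst \<circ> fst) (term_list bs \<sigma>))"
proof -
  obtain xs where "distinct xs" "set xs = (SIGMA B:bs. {..<length (\<sigma> B)})"
    using finite_distinct_list[of "SIGMA B:bs. {..<length (\<sigma> B)}"] assms by auto
  then have "\<exists>ts. distinct ts \<and> set ts = (SIGMA B:bs. {..<length (\<sigma> B)}) \<and>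
      sorted (map (fst \<circ> fst) ts)"
    by (intro exI[of _ "sort_key (fst \<circ> fst) xs"]) simp
  from someI_ex[OF this] show "distinct (term_list bs \<sigma>)"
    "set (term_list bs \<sigma>) = (SIGMA B:bs. {..<length (\<sigma> B)})"
    "sorted (map (fst \<circ> fst) (term_list bs \<sigma>))"
    by (simp_all add: term_list_def)
qed

definition left_expr :: "(nat \<times> nat) list \<Rightarrow> nat \<Rightarrow> nat \<Rightarrow> expr" where
  "left_expr es t p = eliminate_expr (take t es) p (snd (es ! t))"

text \<open>The division by the pivot is put into this factor, which therefore has the value 1 in
  the pivot column.\<close>

definition right_expr :: "(nat \<times> nat) list \<Rightarrow> nat \<Rightarrow> nat \<Rightarrow> expr" where
  "right_expr es t q = Op Divide (eliminate_expr (take t es) (fst (es ! t)) q)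
     (eliminate_expr (take t es) (fst (es ! t)) (snd (es ! t)))"

text \<open>A leaf may depend only on the branches taken, so the format is a function of the
  vanishing set \<open>Z\<close> and not of the matrix.\<close>

definition block_factors ::
    "block set \<Rightarrow> (block \<Rightarrow> (nat \<times> nat) list) \<Rightarrow> expr set \<Rightarrow> fact_result" where
  "block_factors bs \<sigma> Z = (let ts = term_list bs \<sigma> in
     \<lparr>width = length ts,
      entry_C = (\<lambda>p i. let (B, t) = ts ! i; e = left_expr (\<sigma> B) t p in
        if p \<in> block_rows B \<and> e \<notin> Z then Some (eloc e) else None),
      entry_D = (\<lambda>i q. let (B, t) = ts ! i; e = right_expr (\<sigma> B) t q in
        if q \<in> block_cols B \<and> e \<notin> Z then Some (eloc e) else None)\<rparr>)"

text \<open>All expressions that elimination with at most \<open>r\<close> pivots can require,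
  whatever the pivots turn out to be. Depending on \<open>n\<close> and \<open>r\<close> only, the
  set can be evaluated in advance.\<close>

definition candidate_exprs :: "nat \<Rightarrow> nat \<Rightarrow> expr set" where
  "candidate_exprs n r =
    (let es = {es. set es \<subseteq> {..<n} \<times> {..<n} \<and> length es \<le> r} in
     (\<lambda>(es, p, q). eliminate_expr es p q) ` (es \<times> {..<n} \<times> {..<n}) \<union>
     (\<lambda>(es, p, q, q'). Op Divide (eliminate_expr es p q) (eliminate_expr es p q')) `
       (es \<times> {..<n} \<times> {..<n} \<times> {..<n}))"

lemma finite_candidate_exprs: "finite (candidate_exprs n r)"
  unfolding candidate_exprs_def Let_def
  by (intro finite_UnI finite_imageI finite_cartesian_product finite_lists_length_le) auto

lemma candidate_exprsI:
  assumes "set es \<subseteq> {..<n} \<times> {..<n}" "length es \<le> r" "p < n" "q < n"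
  shows "eliminate_expr es p q \<in> candidate_exprs n r"
    and "q' < n \<Longrightarrow> Op Divide (eliminate_expr es p q) (eliminate_expr es p q') \<in> candidate_exprs n r"
  using assms by (force simp: candidate_exprs_def Let_def image_iff)+

text \<open>A complete pivot sequence, recognized from the set \<open>Z\<close> of vanishing expressions.\<close>

definition pattern_pivots :: "nat set \<Rightarrow> nat set \<Rightarrow> nat \<Rightarrow> expr set \<Rightarrow> (nat \<times> nat) list \<Rightarrow> bool" where
  "pattern_pivots I J r Z es \<longleftrightarrow> set es \<subseteq> I \<times> J \<and> length es \<le> r \<and>
     (\<forall>t<length es. eliminate_expr (take t es) (fst (es ! t)) (snd (es ! t)) \<notin> Z) \<and>
     (\<forall>p\<in>I. \<forall>q\<in>J. eliminate_expr es p q \<in> Z)"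

text \<open>Justifies choosing pivots from \<open>Z\<close> alone. The witness is a longest pivot
  sequence of the actual matrix, whose length the rank of the block bounds by
  \<open>r\<close>.\<close>

lemma ex_pattern_pivots:
  assumes A: "A \<in> carrier_mat n n" and IJ: "I \<subseteq> {..<n}" "J \<subseteq> {..<n}"
    and rank: "mat_rank (submatrix A I J) \<le> r"
    and Z: "Z = {e \<in> candidate_exprs n r. val (mat_input n A) e = 0}"
  shows "\<exists>es. pattern_pivots I J r Z es"
proof -
  let ?M = "\<lambda>i j. mat_input n A (i, j)" and ?A = "\<lambda>i j. A $$ (i, j)"
  \<comment> \<open>\<open>mat_input\<close> is total, extended by zero, and agrees with the matrix
    only inside the index range; on \<open>I\<close> and \<open>J\<close> this is enough.\<close>
  have cong: "pivots I J N es \<longleftrightarrow> pivots I J N' es"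
    if "\<And>i j. i \<in> I \<Longrightarrow> j \<in> J \<Longrightarrow> N i j = N' i j" for N N' :: "nat \<Rightarrow> nat \<Rightarrow> real" and es
    using that
  proof (induction es arbitrary: N N')
    case (Cons e es)
    have "pivots I J (pivot_step N e) es \<longleftrightarrow> pivots I J (pivot_step N' e) es"
      if "fst e \<in> I" "snd e \<in> J"
      using Cons.prems that by (intro Cons.IH) (simp add: pivot_step_def)
    then show ?case using Cons.prems by auto
  qed simp
  have "length es \<le> r" if "pivots I J ?M es" for es
  proof -
    have "pivots I J ?M es \<longleftrightarrow> pivots I J ?A es"
      by (rule cong) (use IJ in \<open>auto simp: mat_input_def\<close>)
    then have "pivots I J ?A es" using that by simp
    then show ?thesis using length_pivots_le_rank[OF A IJ] rank le_trans by blast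
  qed
  then obtain es where es: "pivots I J ?M es" "length es \<le> r"
      "\<forall>i\<in>I. \<forall>j\<in>J. eliminate ?M es i j = 0"
    using ex_complete_pivots[of I J ?M r] by blast
  have sub: "set es \<subseteq> I \<times> J"
  proof
    fix e assume "e \<in> set es"
    then obtain t where "t < length es" "es ! t = e" by (auto simp: in_set_conv_nth)
    then show "e \<in> I \<times> J" using pivots_nth[OF es(1)] by (auto simp: mem_Times_iff)
  qed
  then have "set es \<subseteq> {..<n} \<times> {..<n}" using IJ by blast
  then have "eliminate_expr es p q \<in> Z" if "p \<in> I" "q \<in> J" for p q
    unfolding Z using es(2,3) that IJ by (auto intro!: candidate_exprsI simp: val_eliminate_expr)
  moreover have "eliminate_expr (take t es) (fst (es ! t)) (snd (es ! t)) \<notin> Z" if "t < length es" for t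
    using pivots_nth[OF es(1) that] unfolding Z by (simp add: val_eliminate_expr)
  ultimately show ?thesis using sub es(2) unfolding pattern_pivots_def by blast
qed

lemma (in dendro) block_factors_correct:
  assumes A: "A \<in> carrier_mat n n"
    and Z: "Z = {e \<in> candidate_exprs n r. val (mat_input n A) e = 0}"
    and \<sigma>: "\<And>B. B \<in> blocks n h P \<Longrightarrow> pattern_pivots (block_rows B) (block_cols B) r Z (\<sigma> B)"
    and s: "\<And>e. e \<in> candidate_exprs n r \<Longrightarrow> s (eloc e) = val (mat_input n A) e"
    and R: "R = block_factors (blocks n h P) \<sigma> Z"
    and d: "d = max_degree h P"
  shows "only_nonzeros n (width R) (entry_C R) s" "only_nonzeros (width R) n (entry_D R) s"
    "sparse_factorization (r * d * (d - 1) * (h + 1)) A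
      (stored_mat n (width R) (entry_C R) s) (stored_mat (width R) n (entry_D R) s)"
proof -
  define ts where "ts = term_list (blocks n h P) \<sigma>"
  let ?m = "length ts" and ?M = "\<lambda>i j. mat_input n A (i, j)"
  note ts = term_list[OF finite_blocks, of \<sigma>, folded ts_def]
  define U where "U B t p = val (mat_input n A) (left_expr (\<sigma> B) t p)" for B t p
  define V where "V B t q = val (mat_input n A) (right_expr (\<sigma> B) t q)" for B t q
  have sub: "block_rows B \<subseteq> {..<n}" "block_cols B \<subseteq> {..<n}" if "B \<in> blocks n h P" for B
    using that block_subset by (cases B; simp)+
  have mem: "fst (ts ! i) \<in> blocks n h P" "snd (ts ! i) < length (\<sigma> (fst (ts ! i)))"
    if "i < ?m" for i
    using nth_mem[OF that] unfolding ts(2) by auto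
  have piv: "fst (\<sigma> B ! t) \<in> block_rows B" "snd (\<sigma> B ! t) \<in> block_cols B"
      "length (\<sigma> B) \<le> r" "set (take t (\<sigma> B)) \<subseteq> {..<n} \<times> {..<n}" "set (\<sigma> B) \<subseteq> {..<n} \<times> {..<n}"
      "eliminate_expr (take t (\<sigma> B)) (fst (\<sigma> B ! t)) (snd (\<sigma> B ! t)) \<notin> Z"
    if "B \<in> blocks n h P" "t < length (\<sigma> B)" for B t
  proof -
    note p = \<sigma>[OF that(1), unfolded pattern_pivots_def]
    have "\<sigma> B ! t \<in> block_rows B \<times> block_cols B" using p nth_mem[OF that(2)] by blast
    then show "fst (\<sigma> B ! t) \<in> block_rows B" "snd (\<sigma> B ! t) \<in> block_cols B"
      by (auto simp: mem_Times_iff)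
    show "length (\<sigma> B) \<le> r"
      "eliminate_expr (take t (\<sigma> B)) (fst (\<sigma> B ! t)) (snd (\<sigma> B ! t)) \<notin> Z" using p that by auto
    show "set (\<sigma> B) \<subseteq> {..<n} \<times> {..<n}" using p sub[OF that(1)] by blast
    then show "set (take t (\<sigma> B)) \<subseteq> {..<n} \<times> {..<n}" using set_take_subset by fastforce
  qed
  \<comment> \<open>Absence from \<open>Z\<close> means a nonzero value only for candidates, so
    membership among them must be known for each entry used.\<close>
  have left_mem: "left_expr (\<sigma> B) t p \<in> candidate_exprs n r"
    if "B \<in> blocks n h P" "t < length (\<sigma> B)" "p \<in> block_rows B" for B t p
    unfolding left_expr_def using piv[OF that(1,2)] sub[OF that(1)] that(3)
    by (intro candidate_exprsI) auto
  have right_mem: "right_expr (\<sigma> B) t q \<in> candidate_exprs n r"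
    if "B \<in> blocks n h P" "t < length (\<sigma> B)" "q \<in> block_cols B" for B t q
    unfolding right_expr_def using piv[OF that(1,2)] sub[OF that(1)] that(3)
    by (intro candidate_exprsI(2)) auto
  have width: "width R = ?m" by (simp add: R block_factors_def ts_def Let_def)
  have entry_C: "entry_C R p i = (if p \<in> block_rows (fst (ts ! i)) \<and>
      left_expr (\<sigma> (fst (ts ! i))) (snd (ts ! i)) p \<notin> Z
      then Some (eloc (left_expr (\<sigma> (fst (ts ! i))) (snd (ts ! i)) p)) else None)" for p i
    by (simp add: R block_factors_def Let_def case_prod_beta flip: ts_def)
  have entry_D: "entry_D R i q = (if q \<in> block_cols (fst (ts ! i)) \<and>
      right_expr (\<sigma> (fst (ts ! i))) (snd (ts ! i)) q \<notin> Z
      then Some (eloc (right_expr (\<sigma> (fst (ts ! i))) (snd (ts ! i)) q)) else None)" for q i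
    by (simp add: R block_factors_def Let_def case_prod_beta flip: ts_def)
  show "only_nonzeros n (width R) (entry_C R) s"
    unfolding only_nonzeros_def width entry_C
    using left_mem mem s Z by (auto split: if_splits)
  show "only_nonzeros (width R) n (entry_D R) s"
    unfolding only_nonzeros_def width entry_D
    using right_mem mem s Z by (auto split: if_splits)
  define Cm where "Cm = stored_mat n (width R) (entry_C R) s"
  define Dm where "Dm = stored_mat (width R) n (entry_D R) s"
  have dims: "dim_row Cm = n" "dim_col Cm = ?m" "dim_row Dm = ?m" "dim_col Dm = n"
    by (simp_all add: Cm_def Dm_def stored_mat_def width)
  have Cm: "Cm $$ (p, i) = (if p \<in> block_rows (fst (ts ! i)) then U (fst (ts ! i)) (snd (ts ! i)) p else 0)"
    if "p < n" "i < ?m" for p i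
    using that left_mem[OF mem(1)[OF that(2)] mem(2)[OF that(2)], of p] s
    by (auto simp: Cm_def stored_mat_def width entry_C U_def Z)
  have Dm: "Dm $$ (i, q) = (if q \<in> block_cols (fst (ts ! i)) then V (fst (ts ! i)) (snd (ts ! i)) q else 0)"
    if "i < ?m" "q < n" for q i
    using that right_mem[OF mem(1)[OF that(1)] mem(2)[OF that(1)], of q] s
    by (auto simp: Dm_def stored_mat_def width entry_D V_def Z)
  \<comment> \<open>The pivot positions witness that no column of \<open>C\<close> and no row of
    \<open>D\<close> is zero.\<close>
  have pivot_nz: "U B t (fst (\<sigma> B ! t)) \<noteq> 0" "V B t (snd (\<sigma> B ! t)) = 1"
    if "B \<in> blocks n h P" "t < length (\<sigma> B)" for B t
  proof -
    note p = piv[OF that]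
    have "left_expr (\<sigma> B) t (fst (\<sigma> B ! t)) \<notin> Z" using p(6) by (simp add: left_expr_def)
    then show "U B t (fst (\<sigma> B ! t)) \<noteq> 0" using left_mem[OF that p(1)] by (simp add: U_def Z)
    then show "V B t (snd (\<sigma> B ! t)) = 1" by (simp add: U_def V_def left_expr_def right_expr_def)
  qed
  have block_sum: "A $$ (p, q) = (\<Sum>t<length (\<sigma> B). U B t p * V B t q)"
    if "B \<in> blocks n h P" "p \<in> block_rows B" "q \<in> block_cols B" for B p q
  proof -
    have pq: "p < n" "q < n" using sub[OF that(1)] that(2,3) by auto
    have "eliminate_expr (\<sigma> B) p q \<in> Z" using \<sigma>[OF that(1)] that(2,3) by (simp add: pattern_pivots_def)
    then have "eliminate ?M (\<sigma> B) p q = 0" by (simp add: Z val_eliminate_expr)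
    then show ?thesis
      using eliminate_decomposition[of ?M p q "\<sigma> B"] pq
      by (simp add: U_def V_def left_expr_def right_expr_def val_eliminate_expr mat_input_def)
  qed
  have product: "A = Cm * Dm"
  proof (rule eq_matI)
    fix p q assume "p < dim_row (Cm * Dm)" "q < dim_col (Cm * Dm)"
    then have pq: "p < n" "q < n" by (simp_all add: dims)
    define g where "g B t = (if p \<in> block_rows B \<and> q \<in> block_cols B then U B t p * V B t q else 0)" for B t
    obtain B where B: "B \<in> blocks n h P" "p \<in> block_rows B" "q \<in> block_cols B"
      and unique: "\<And>B'. B' \<in> blocks n h P \<Longrightarrow> p \<in> block_rows B' \<Longrightarrow> q \<in> block_cols B' \<Longrightarrow> B' = B"
      using ex1_block[OF pq] by metis
    \<comment> \<open>Only the unique block containing \<open>(p, q)\<close> contributes to this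
      entry of the product.\<close>
    have g_zero: "g B' t = 0" if "B' \<in> blocks n h P" "B' \<noteq> B" for B' t
      using unique[OF that(1)] that(2) unfolding g_def by meson
    have "(Cm * Dm) $$ (p, q) = (\<Sum>i<?m. Cm $$ (p, i) * Dm $$ (i, q))"
      using pq by (simp add: dims scalar_prod_def atLeast0LessThan)
    also have "\<dots> = (\<Sum>i<?m. g (fst (ts ! i)) (snd (ts ! i)))"
      using pq by (intro sum.cong) (auto simp: Cm Dm g_def)
    also have "\<dots> = (\<Sum>x\<in>set ts. g (fst x) (snd x))"
      using sum.reindex_bij_betw[OF bij_betw_nth[OF ts(1) refl refl], of "\<lambda>x. g (fst x) (snd x)"] .
    also have "\<dots> = (\<Sum>B\<in>blocks n h P. \<Sum>t<length (\<sigma> B). g B t)"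
      unfolding ts(2) by (simp add: sum.Sigma finite_blocks case_prod_beta)
    also have "\<dots> = (\<Sum>B'\<in>{B}. \<Sum>t<length (\<sigma> B'). g B' t)"
      using B(1) g_zero by (intro sum.mono_neutral_right finite_blocks) (simp_all add: sum.neutral)
    also have "\<dots> = A $$ (p, q)" using block_sum[OF B] B by (simp add: g_def)
    finally show "A $$ (p, q) = (Cm * Dm) $$ (p, q)" by simp
  qed (use A in \<open>simp_all add: dims\<close>)
  have C_cols: "supp (col Cm i) \<noteq> {}" if "i < ?m" for i
  proof -
    let ?p = "fst (\<sigma> (fst (ts ! i)) ! snd (ts ! i))"
    have "?p \<in> block_rows (fst (ts ! i))" using piv(1) mem[OF that] by blast
    moreover from this have "?p < n" using sub(1) mem(1)[OF that] by blast
    ultimately have "?p \<in> supp (col Cm i)"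
      using Cm[of ?p i] pivot_nz(1) mem[OF that] that by (simp add: supp_def dims)
    then show ?thesis by blast
  qed
  have D_rows: "supp (row Dm i) \<noteq> {}" if "i < ?m" for i
  proof -
    let ?q = "snd (\<sigma> (fst (ts ! i)) ! snd (ts ! i))"
    have "?q \<in> block_cols (fst (ts ! i))" using piv(2) mem[OF that] by blast
    moreover from this have "?q < n" using sub(2) mem(1)[OF that] by blast
    ultimately have "?q \<in> supp (row Dm i)"
      using Dm[of i ?q] pivot_nz(2) mem[OF that] that by (simp add: supp_def dims)
    then show ?thesis by blast
  qed
  have sparse: "card (\<Union>i\<in>supp (col Dm q). forward_overlap Cm i) \<le> r * d * (d - 1) * (h + 1)"
    if q: "q < n" for q
  proof -
    define W where "W = {(0::nat, {q}, {q})} \<times> {..<r} \<union>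
      (\<Union>i\<in>{1..h}. (\<lambda>((I, J), t). ((i, I, J), t)) `
        ({(I, J). I \<in> children P i (node P i q) \<and> J \<in> children P i (node P i q) \<and> I \<noteq> J} \<times> {..<r}))"
    have "finite W"
      unfolding W_def
    proof (intro finite_UnI finite_UN_I finite_imageI finite_cartesian_product)
      fix i assume "i \<in> {1..h}"
      then have fin: "finite (children P i (node P i q))" using finite_children by simp
      show "finite {(I, J). I \<in> children P i (node P i q) \<and> J \<in> children P i (node P i q) \<and> I \<noteq> J}"
        by (rule finite_subset[of _ "children P i (node P i q) \<times> children P i (node P i q)"])
          (use fin in auto)
    qed auto
    \<comment> \<open>The block of term \<open>i\<close> has \<open>q\<close> as a column and some
      \<open>p\<close> as a row, so \<open>p\<close> and \<open>q\<close> share a node at its height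
      \<open>l\<close>. Term \<open>i'\<close> meets it in row \<open>p\<close>, and sorting gives
      \<open>l \<le> l'\<close>, so \<open>p\<close> and \<open>q\<close> share a node at height
      \<open>l'\<close> too. For \<open>l' > 0\<close> the block of \<open>i'\<close> subdivides
      precisely that node, and for \<open>l' = 0\<close> it is the diagonal block of
      \<open>q\<close>.\<close>
    have in_W: "ts ! i' \<in> W" if i: "i \<in> supp (col Dm q)" and i': "i' \<in> forward_overlap Cm i" for i i'
    proof -
      have i_lt: "i < ?m" "Dm $$ (i, q) \<noteq> 0" using i q by (auto simp: supp_def dims)
      have i'_lt: "i' < ?m" "i \<le> i'" "supp (col Cm i) \<inter> supp (col Cm i') \<noteq> {}"
        using i' by (auto simp: forward_overlap_def dims)
      then obtain p where p: "p < n" "Cm $$ (p, i) \<noteq> 0" "Cm $$ (p, i') \<noteq> 0"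
        using i_lt(1) by (auto simp: supp_def dims)
      obtain l I J t where ti: "ts ! i = ((l, I, J), t)" by (metis prod.collapse)
      obtain l' I' J' t' where ti': "ts ! i' = ((l', I', J'), t')" by (metis prod.collapse)
      have B: "(l, I, J) \<in> blocks n h P" using mem(1)[OF i_lt(1)] ti by simp
      have B': "(l', I', J') \<in> blocks n h P" "t' < length (\<sigma> (l', I', J'))"
        using mem[OF i'_lt(1)] ti' by auto
      have "t' < r" using piv(3)[OF B'] B'(2) by simp
      have "q \<in> J" using Dm[OF i_lt(1) q] i_lt(2) ti by (auto split: if_splits)
      have "p \<in> I" using Cm[OF p(1) i_lt(1)] p(2) ti by (auto split: if_splits)
      have "p \<in> I'" using Cm[OF p(1) i'_lt(1)] p(3) ti' by (auto split: if_splits)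
      have "map (fst \<circ> fst) ts ! i \<le> map (fst \<circ> fst) ts ! i'"
        using ts(3) i'_lt by (intro sorted_nth_mono) auto
      then have "l \<le> l'" using i_lt(1) i'_lt(1) ti ti' by simp
      have same: "node P l p = node P l q \<and> l \<le> h"
      proof (cases "l = 0")
        case True
        then have "p = q" using B \<open>p \<in> I\<close> \<open>q \<in> J\<close> by (auto simp: blocks_def)
        then show ?thesis using True by simp
      next
        case False
        then obtain X where X: "1 \<le> l" "l \<le> h" "X \<in> P l" "I \<in> children P l X" "J \<in> children P l X"
          using B by (auto simp: blocks_def)
        then show ?thesis
          using childD(5)[OF X(1-4) \<open>p \<in> I\<close>] childD(5)[OF X(1-3,5) \<open>q \<in> J\<close>] by simp
      qed
      show "ts ! i' \<in> W"
      proof (cases "l' = 0")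
        case True
        then have "l = 0" using \<open>l \<le> l'\<close> by simp
        then have "p = q" using B \<open>p \<in> I\<close> \<open>q \<in> J\<close> by (auto simp: blocks_def)
        then have "I' = {q} \<and> J' = {q}" using B'(1) True \<open>p \<in> I'\<close> by (auto simp: blocks_def)
        then show ?thesis using ti' True \<open>t' < r\<close> by (simp add: W_def)
      next
        case False
        then obtain X where X: "1 \<le> l'" "l' \<le> h" "X \<in> P l'" "I' \<in> children P l' X"
            "J' \<in> children P l' X" "I' \<noteq> J'"
          using B'(1) by (auto simp: blocks_def)
        have "X = node P l' p" using childD(5)[OF X(1-4) \<open>p \<in> I'\<close>] by simp
        also have "\<dots> = node P l' q" using node_cong[OF \<open>l \<le> l'\<close> X(2) p(1) q] same by simp
        finally have "((I', J'), t') \<in> {(I, J). I \<in> children P l' (node P l' q) \<and>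
            J \<in> children P l' (node P l' q) \<and> I \<noteq> J} \<times> {..<r}"
          using X \<open>t' < r\<close> by simp
        then have "((l', I', J'), t') \<in> (\<lambda>((I, J), t). ((l', I, J), t)) `
            ({(I, J). I \<in> children P l' (node P l' q) \<and>
            J \<in> children P l' (node P l' q) \<and> I \<noteq> J} \<times> {..<r})"
          by (rule rev_image_eqI) simp
        then show ?thesis unfolding W_def ti' using X(1,2) by (intro UnI2 UN_I[of l']) auto
      qed
    qed
    let ?O = "\<Union>i\<in>supp (col Dm q). forward_overlap Cm i"
    have "?O \<subseteq> {..<?m}" by (auto simp: forward_overlap_def dims)
    \<comment> \<open>Terms are listed without repetition, so counting column indices amounts to
      counting terms.\<close>
    then have "inj_on (nth ts) ?O" using inj_on_nth[OF ts(1)] by blast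
    moreover have "nth ts ` ?O \<subseteq> W" using in_W by blast
    ultimately have "card ?O \<le> card W" using card_inj_on_le \<open>finite W\<close> by blast
    also have "\<dots> \<le> r * d * (d - 1) * (h + 1)"
      unfolding W_def d by (rule card_reachable_terms[OF q])
    finally show ?thesis .
  qed
  show "sparse_factorization (r * d * (d - 1) * (h + 1)) A
      (stored_mat n (width R) (entry_C R) s) (stored_mat (width R) n (entry_D R) s)"
    unfolding sparse_factorization_def Cm_def[symmetric] Dm_def[symmetric]
    using product C_cols D_rows sparse dims A by auto
qed

lemma (in dendro) ex_factorization_prog:
  "\<exists>F. \<forall>A\<in>{A. hierarchical_mat n h P r A}.
    computes_sparse_factorization n (r * max_degree h P * (max_degree h P - 1) * (h + 1)) F A"
proof -
  \<comment> \<open>The choice depends on \<open>Z\<close> only, hence is the same for all matrices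
    with this zero pattern.\<close>
  define \<sigma> where "\<sigma> Z B = (SOME es. pattern_pivots (block_rows B) (block_cols B) r Z es)" for Z B
  define g where "g Z = block_factors (blocks n h P) (\<sigma> Z) Z" for Z
  \<comment> \<open>Position \<open>(n, n)\<close> lies just outside the matrix, where
    \<open>mat_input\<close> is zero.\<close>
  obtain F where F: "\<And>v. v (n, n) = 0 \<Longrightarrow> \<exists>s t. exec F (init_store v) =
      (g {e \<in> candidate_exprs n r. val v e = 0}, s, t) \<and>
      (\<forall>e\<in>candidate_exprs n r. s (eloc e) = val v e)"
    using ex_zero_pattern_prog[OF finite_candidate_exprs, of "(n, n)" g] by blast
  have "computes_sparse_factorization n (r * max_degree h P * (max_degree h P - 1) * (h + 1)) F A"
    if "hierarchical_mat n h P r A" for A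
  proof -
    define Z where "Z = {e \<in> candidate_exprs n r. val (mat_input n A) e = 0}"
    have A: "A \<in> carrier_mat n n"
      and rank: "\<And>I J. (I, J) \<in> elementary_blocks P h {..<n} \<Longrightarrow> mat_rank (submatrix A I J) \<le> r"
      using that by (auto simp: hierarchical_mat_def)
    have "pattern_pivots (block_rows B) (block_cols B) r Z (\<sigma> Z B)" if "B \<in> blocks n h P" for B
    proof -
      obtain i I J where [simp]: "B = (i, I, J)" by (cases B)
      have "\<exists>es. pattern_pivots I J r Z es"
        using that block_subset rank[OF block_elementary] A Z_def
        by (intro ex_pattern_pivots[of A n]) auto
      from someI_ex[OF this] show ?thesis by (simp add: \<sigma>_def)
    qed
    moreover obtain s t where s: "exec F (init_store (mat_input n A)) = (g Z, s, t)"
        "\<forall>e\<in>candidate_exprs n r. s (eloc e) = val (mat_input n A) e"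
      using F[of "mat_input n A"] by (auto simp: mat_input_def Z_def)
    ultimately show ?thesis
      using block_factors_correct[OF A Z_def, of "\<sigma> Z" s "g Z" "max_degree h P"]
      unfolding computes_sparse_factorization_def run_factorization_def by (simp add: g_def)
  qed
  then show ?thesis by blast
qed

section \<open>The bound in terms of \<open>N\<close>, \<open>n\<close>, \<open>r\<close>,
  \<open>d\<close> and \<open>h\<close>\<close>

theorem theorem5p2:
  shows "\<exists>K::nat. \<forall>(n::nat) (h::nat) (d::nat) (r::nat) (P :: nat \<Rightarrow> nat set set).
    n \<ge> 2 \<longrightarrow> dendrogram n h P \<longrightarrow> max_degree h P = d \<longrightarrow>
    (let k = r * d * (d - 1) * (h + 1);
         \<A> = {A. hierarchical_mat n h P r A \<and> invertible_mat A}
     in (\<exists>F. \<forall>A\<in>\<A>. computes_sparse_factorization n k F A) \<and>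
        (\<forall>F. (\<forall>A\<in>\<A>. computes_sparse_factorization n k F A) \<longrightarrow>
          (\<exists>S. \<forall>A\<in>\<A>. \<forall>b\<in>carrier_vec n. \<forall>y0\<in>carrier_vec n. \<forall>N picks.
             length picks = N \<longrightarrow> set picks \<subseteq> {..<n} \<longrightarrow>
             solves_iteratively_within n S A b y0 picks
               (K * (N * r * d^2 * h + n * r^2 * d^4 * h^2) + factorization_cost n F A))))"
proof (intro exI[of _ 132] allI impI)
  fix n h d r :: nat and P :: "nat \<Rightarrow> nat set set"
  assume n: "n \<ge> 2" and P: "dendrogram n h P" and d: "max_degree h P = d"
  interpret dendro n h P using n P by unfold_locales
  define k where "k = r * d * (d - 1) * (h + 1)"
  define \<A> where "\<A> = {A. hierarchical_mat n h P r A \<and> invertible_mat A}"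
  have k_le: "k \<le> 2 * (r * d^2 * h)"
  proof -
    have "h + 1 \<le> 2 * h" using height_pos by simp
    then have "r * d * (d - 1) * (h + 1) \<le> r * d * d * (2 * h)" by (intro mult_le_mono) auto
    then show ?thesis by (simp add: k_def power2_eq_square mult_ac)
  qed
  have "\<exists>F. \<forall>A\<in>\<A>. computes_sparse_factorization n k F A"
    using ex_factorization_prog[of r] unfolding k_def d \<A>_def by blast
  moreover have "solves_iteratively_within n (sparse_solver n F) A b y0 picks
      (132 * (N * r * d^2 * h + n * r^2 * d^4 * h^2) + factorization_cost n F A)"
    if F: "\<forall>A\<in>\<A>. computes_sparse_factorization n k F A" and A: "A \<in> \<A>"
      and b: "b \<in> carrier_vec n" and y0: "y0 \<in> carrier_vec n"
      and picks: "length picks = N" "set picks \<subseteq> {..<n}"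
    for F A b y0 N picks
  proof -
    have A': "A \<in> carrier_mat n n" "invertible_mat A" "computes_sparse_factorization n k F A"
      using A F by (auto simp: \<A>_def hierarchical_mat_def)
    \<comment> \<open>The formula alone does not give this, as \<open>k = 0\<close> for
      \<open>r = 0\<close>; it follows because an invertible matrix has a k-sparse
      factorization.\<close>
    then have "1 \<le> k"
      using sparse_factorization_bound_pos[of A n k] n
      by (auto simp: computes_sparse_factorization_def split: prod.splits)
    then have "solves_iteratively_within n (sparse_solver n F) A b y0 picks
        (33 * (n * k * k) + 19 * k * length picks + factorization_cost n F A)"
      using sparse_solver_solves[OF A'(1,3) b y0 picks(2)] n by simp
    moreover have "33 * (n * k * k) + 19 * k * length picks \<le>
        132 * (N * r * d^2 * h + n * r^2 * d^4 * h^2)"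
    proof -
      \<comment> \<open>Both factors \<open>k\<close> contribute a 2, which turns 33 into 132; the
        iterations only need 19 * 2 = 38.\<close>
      have "33 * (n * k * k) \<le> 33 * (n * (2 * (r * d^2 * h)) * (2 * (r * d^2 * h)))"
        using k_le by (intro mult_le_mono) auto
      also have "\<dots> = 132 * (n * r^2 * d^4 * h^2)"
        by (simp add: power2_eq_square power4_eq_xxxx mult_ac)
      finally have "33 * (n * k * k) \<le> 132 * (n * r^2 * d^4 * h^2)" .
      moreover have "19 * k * length picks \<le> 19 * (2 * (r * d^2 * h)) * N"
        using k_le picks(1) by (intro mult_le_mono) auto
      then have "19 * k * length picks \<le> 38 * (N * r * d^2 * h)" by (simp add: mult_ac)
      moreover have "x + y \<le> 132 * (a + b)" if "x \<le> 132 * b" "y \<le> 38 * a" for x y a b :: nat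
      proof -
        have "38 * a \<le> 132 * a" by (intro mult_le_mono) auto
        then have "y \<le> 132 * a" using that(2) le_trans by blast
        then show ?thesis using that(1) add_mono[of y "132 * a" x "132 * b"]
          by (simp add: distrib_left add.commute)
      qed
      ultimately show ?thesis by blast
    qed
    ultimately show ?thesis
      by (auto simp: solves_iteratively_within_def split: prod.splits intro: order_trans)
  qed
  ultimately show "let k = r * d * (d - 1) * (h + 1);
      \<A> = {A. hierarchical_mat n h P r A \<and> invertible_mat A}
     in (\<exists>F. \<forall>A\<in>\<A>. computes_sparse_factorization n k F A) \<and>
        (\<forall>F. (\<forall>A\<in>\<A>. computes_sparse_factorization n k F A) \<longrightarrow>
          (\<exists>S. \<forall>A\<in>\<A>. \<forall>b\<in>carrier_vec n. \<forall>y0\<in>carrier_vec n. \<forall>N picks.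
             length picks = N \<longrightarrow> set picks \<subseteq> {..<n} \<longrightarrow>
             solves_iteratively_within n S A b y0 picks
               (132 * (N * r * d^2 * h + n * r^2 * d^4 * h^2) + factorization_cost n F A)))"
    unfolding Let_def k_def[symmetric] \<A>_def[symmetric] by blast
qed

end
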